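(* Let $n\ge 1$ be an integer, let $Q_0=[0,1]^n$, and let $\phi:Q_0\to[0,\infty)$ be a measurable function. Suppose that for some fixed constants $p>1$ and $c\ge 1$, $$\frac{1}{|Q|}\int_Q\phi^p\,dx\le c\left(\frac{1}{|Q|}\int_Q\phi\,dx\right)^p$$ for every dyadic subcube $Q$ of $Q_0$. Let $h=\phi^\ast:(0,1]\to[0,\infty)$ be the non-increasing rearrangement of $\phi$. Then $$\frac{1}{t}\int_0^t h(u)^p\,du\le(2^nc-2^n+1)\left(\frac{1}{t}\int_0^t h(u)\,du\right)^p\qquad\text{for every } t\in(0,1].$$
   Context: $|\cdot|$ denotes Lebesgue measure. The dyadic subcubes of $Q_0=[0,1]^n$ are the cubes obtained by starting from $Q_0$ itself and repeatedly bisecting all the sides, so that each dyadic cube is divided into $2^n$ congruent dyadic subcubes (disjoint up to sets of measure zero). Integrals of non-negative functions are taken as values in $[0,\infty]$. The non-increasing rearrangement of $\phi$ is defined on $(0,1]$ by $$\phi^\ast(t)=\sup_{E\subseteq Q_0,\ |E|=t}\ \inf_{x\in E}|\phi(x)|,$$ the supremum being over measurable sets $E$; equivalently, it is the unique left-continuous non-increasing function on $(0,1]$ that is equimeasurable with $|\phi|$, i.e. $|\{|\phi|>\lambda\}|=|\{\phi^\ast>\lambda\}|$ for every $\lambda>0$. *)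

theory Defs
  imports "HOL-Analysis.Analysis"
begin

abbreviation unit_cube :: "(real ^ 'n::finite) set" where
  "unit_cube \<equiv> cbox 0 1"

text \<open>Each application of the second rule halves all sides of a cube at once and chooses, in every
  coordinate independently, the lower or the upper half.\<close>

inductive dyadic_subcube :: "(real ^ 'n::finite) set \<Rightarrow> bool" where
  whole: "dyadic_subcube unit_cube"
| bisect: "dyadic_subcube (cbox a b) \<Longrightarrow>
    (\<And>i. (c $ i = a $ i \<and> d $ i = (a $ i + b $ i) / 2) \<or>
          (c $ i = (a $ i + b $ i) / 2 \<and> d $ i = b $ i)) \<Longrightarrow>
    dyadic_subcube (cbox c d)"

text \<open>The power \<open>x\<^sup>p\<close> on \<open>[0,\<infinity>]\<close>; only used for \<open>p > 0\<close>, where \<open>\<infinity>\<^sup>p = \<infinity>\<close>.\<close>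

definition ennreal_powr :: "ennreal \<Rightarrow> real \<Rightarrow> ennreal" where
  "ennreal_powr x p = (if x = \<infinity> then \<infinity> else ennreal (enn2real x powr p))"

text \<open>Supremum and infimum are taken in the reals. For measurable \<open>\<phi>\<close> and \<open>0 < t \<le> 1\<close> both are over
  non-empty sets with the required bound, see \<open>rearrangement_levels\<close> below; values at other \<open>t\<close> carry
  no meaning.\<close>

definition rearrangement :: "(real ^ 'n::finite \<Rightarrow> real) \<Rightarrow> real \<Rightarrow> real" where
  "rearrangement \<phi> t =
    (SUP E \<in> {E. E \<subseteq> unit_cube \<and> E \<in> sets lebesgue \<and> emeasure lebesgue E = ennreal t}.
      INF x \<in> E. \<bar>\<phi> x\<bar>)"

lemma rearrangement_levels:
  fixes \<phi> :: "real ^ 'n::finite \<Rightarrow> real"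
  assumes meas: "\<phi> \<in> borel_measurable (lebesgue_on unit_cube)" and t: "0 < t" "t \<le> 1"
  defines "\<E> \<equiv> {E. E \<subseteq> unit_cube \<and> E \<in> sets lebesgue \<and> emeasure lebesgue E = ennreal t}"
  shows "\<E> \<noteq> {}"
    and "\<And>E. E \<in> \<E> \<Longrightarrow> E \<noteq> {} \<and> bdd_below ((\<lambda>x. \<bar>\<phi> x\<bar>) ` E)"
    and "bdd_above ((\<lambda>E. INF x \<in> E. \<bar>\<phi> x\<bar>) ` \<E>)"
proof -
  define k :: 'n where "k = undefined"
  define b :: "real ^ 'n" where "b = (\<chi> i. if i = k then t else 1)"
  have sub: "cbox 0 b \<subseteq> unit_cube"
    using t by (auto simp: mem_box_cart b_def split: if_splits) (metis order_trans)+
  have "0 \<le> b $ i" for i using t by (simp add: b_def)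
  then have "measure lborel (cbox 0 b) = (\<Prod>i\<in>UNIV. b $ i)"
    by (subst content_cbox_cart) (auto simp: mem_box_cart box_ne_empty Basis_vec_def inner_axis)
  also have "\<dots> = t"
    by (simp add: b_def prod.If_cases)
  finally have "emeasure lebesgue (cbox 0 b) = ennreal t"
    by (simp add: emeasure_eq_ennreal_measure emeasure_lborel_cbox_finite[unfolded infinity_ennreal_def, THEN less_imp_neq])
  then show "\<E> \<noteq> {}" using sub by (auto simp: \<E>_def intro!: exI[of _ "cbox 0 b"])
  show bb: "E \<noteq> {} \<and> bdd_below ((\<lambda>x. \<bar>\<phi> x\<bar>) ` E)" if "E \<in> \<E>" for E
    using that t by (auto simp: \<E>_def intro!: bdd_belowI[of _ 0])
  let ?M = "lebesgue_on (unit_cube :: (real ^ 'n) set)"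
  define A where "A N = {x \<in> space ?M. \<bar>\<phi> x\<bar> > real N}" for N
  have Asets: "A N \<in> sets ?M" for N unfolding A_def using meas by measurable
  have fin: "emeasure ?M X \<noteq> \<infinity>" for X
  proof -
    have "emeasure ?M X \<le> emeasure ?M (space ?M)" by (rule emeasure_space)
    also have "\<dots> < \<infinity>" by (simp add: emeasure_restrict_space emeasure_lborel_cbox_finite[unfolded infinity_ennreal_def])
    finally show ?thesis by simp
  qed
  have "(\<lambda>N. emeasure ?M (A N)) \<longlonglongrightarrow> emeasure ?M (\<Inter>N. A N)"
    using Asets fin by (intro Lim_emeasure_decseq) (auto simp: A_def decseq_def)
  moreover have "(\<Inter>N. A N) = {}"
    by (auto simp: A_def) (meson real_arch_simple not_less)
  ultimately have "(\<lambda>N. emeasure ?M (A N)) \<longlonglongrightarrow> 0" by simp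
  then have "\<forall>\<^sub>F N in sequentially. emeasure ?M (A N) < ennreal t"
    using t by (intro order_tendstoD) auto
  then obtain N where N: "emeasure ?M (A N) < ennreal t"
    by (auto simp: eventually_sequentially)
  have "(INF x \<in> E. \<bar>\<phi> x\<bar>) \<le> real N" if E: "E \<in> \<E>" for E
  proof -
    have "\<exists>x\<in>E. \<bar>\<phi> x\<bar> \<le> real N"
    proof (rule ccontr)
      assume "\<not> ?thesis"
      with E have "E \<subseteq> A N" by (auto simp: A_def \<E>_def)
      then have "emeasure ?M E \<le> emeasure ?M (A N)" using Asets by (rule emeasure_mono)
      moreover have "emeasure ?M E = ennreal t"
        using E by (simp add: \<E>_def emeasure_restrict_space)
      ultimately show False using N by simp
    qed
    then obtain x where "x \<in> E" "\<bar>\<phi> x\<bar> \<le> real N" by auto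
    then show ?thesis using bb[OF E] by (meson cINF_lower order_trans)
  qed
  then show "bdd_above ((\<lambda>E. INF x \<in> E. \<bar>\<phi> x\<bar>) ` \<E>)" by (auto intro!: bdd_aboveI)
qed

end

theory Submission
  imports Defs
begin

text \<open>Fix \<open>t\<close>, let \<open>\<eta> = h(t)\<close>, let \<open>A\<close> be the mean of \<open>h\<close> over \<open>(0,t]\<close>, and let \<open>\<psi>(x)\<close> be \<open>x\<^sup>p\<close> minus its chord
  through \<open>\<eta>\<close> and \<open>A\<close>. By equimeasurability the claim is that the integral of
  \<open>\<psi>(\<phi>) - \<kappa> (\<phi> - \<eta>)\<close> over \<open>{\<phi> > \<eta>}\<close> is at most \<open>0\<close>, where \<open>\<kappa> = 2\<^sup>n (c - 1) A\<^sup>p / (A - \<eta>)\<close>. Almost every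
  point with \<open>\<phi> > A\<close> lies in a dyadic cube of mean at most \<open>A\<close> that has a child of mean greater than
  \<open>A\<close>; maximal such cubes are disjoint, and off their union the integrand is at most \<open>0\<close> since \<open>\<psi> \<le> 0\<close>
  on \<open>[\<eta>,A]\<close>. On each of these cubes one enlarges the child together with \<open>{\<phi> > A}\<close> by a weight until
  the mean is exactly \<open>A\<close>; convexity and the reverse Hoelder inequality on the cube then give the
  bound, the factor \<open>2\<^sup>n\<close> being the ratio of the volumes of the cube and its child.\<close>

section \<open>Convexity and a single cube\<close>

text \<open>Young's inequality for the product of \<open>x\<close> and
  \<open>a powr (p - 1)\<close>, with conjugate exponents \<open>p\<close> and
  \<open>p / (p - 1)\<close>, rearranges to the tangent line inequality for the power
  function.\<close>

lemma powr_tangent_le: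
  fixes a x p :: real
  assumes "0 < a" "0 \<le> x" "1 < p"
  shows "a powr p + p * a powr (p - 1) * (x - a) \<le> x powr p"
proof -
  have "x * a powr (p - 1) \<le> x powr p / p + (a powr (p - 1)) powr (p / (p - 1)) / (p / (p - 1))"
    using assms by (intro Youngs_inequality) (auto simp: field_simps)
  also have "(a powr (p - 1)) powr (p / (p - 1)) = a powr p"
    using assms by (simp add: powr_powr)
  finally have "p * (x * a powr (p - 1)) \<le> x powr p + (p - 1) * a powr p"
    using assms by (simp add: field_simps)
  moreover have "a powr p = a * a powr (p - 1)"
    using assms by (simp add: powr_mult_base)
  ultimately show ?thesis by (simp add: algebra_simps)
qed

text \<open>Convexity without division. The tangent inequalities at \<open>x\<close>, evaluated at
  \<open>u\<close> and \<open>v\<close> and weighted by \<open>v - x\<close> and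
  \<open>x - u\<close>, are added; the slope terms cancel.\<close>

lemma powr_three_point:
  fixes u x v p :: real
  assumes "0 \<le> u" "u \<le> x" "x \<le> v" "1 < p"
  shows "(v - u) * x powr p \<le> (v - x) * u powr p + (x - u) * v powr p"
\<comment> \<open>The tangent inequality needs a positive base point; for \<open>x = 0\<close> also
  \<open>u = 0\<close>.\<close>
proof (cases "x = 0")
  case True
  then show ?thesis using assms by auto
next
  case False
  let ?d = "p * x powr (p - 1)"
  have "(v - x) * (x powr p + ?d * (u - x)) \<le> (v - x) * u powr p"
    using assms False by (intro mult_left_mono powr_tangent_le) auto
  moreover have "(x - u) * (x powr p + ?d * (v - x)) \<le> (x - u) * v powr p"
    using assms False by (intro mult_left_mono powr_tangent_le) auto
  ultimately show ?thesis by (simp add: algebra_simps)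
qed

text \<open>This is \<open>A - \<eta>\<close> times the difference between \<open>x\<^sup>p\<close> and the chord of the power function through
  \<open>\<eta>\<close> and \<open>A\<close>; the factor avoids division.\<close>

definition chord_gap :: "real \<Rightarrow> real \<Rightarrow> real \<Rightarrow> real \<Rightarrow> real" where
  "chord_gap p \<eta> A x = (A - \<eta>) * (x powr p - A powr p) - (A powr p - \<eta> powr p) * (x - A)"

lemma chord_gap_nonpos:
  assumes "0 \<le> \<eta>" "\<eta> \<le> x" "x \<le> A" "1 < p"
  shows "chord_gap p \<eta> A x \<le> 0"
  using powr_three_point[of \<eta> x A p] assms by (simp add: chord_gap_def algebra_simps)

text \<open>Outside the interval the extended chord lies below the power function: this is the
  three-point inequality with \<open>A\<close> or \<open>\<eta>\<close> as the middle point.\<close>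

lemma chord_gap_nonneg:
  assumes "0 \<le> x" "0 \<le> \<eta>" "\<eta> \<le> A" "1 < p" "x \<le> \<eta> \<or> A \<le> x"
  shows "0 \<le> chord_gap p \<eta> A x"
  using powr_three_point[of \<eta> A x p] powr_three_point[of x \<eta> A p] assms
  by (auto simp add: chord_gap_def algebra_simps)

text \<open>The space is a cube of mean at most \<open>A\<close> and \<open>Q\<close> a child of mean greater than \<open>A\<close>. A weight \<open>w\<close> that
  is \<open>1\<close> on \<open>Q\<close> and on \<open>{f > A}\<close>, and a constant in \<open>[0,1]\<close> elsewhere, can be chosen such that the
  weighted mean of \<open>f\<close> is exactly \<open>A\<close>. The integral of \<open>(1 - w) f\<^sup>p\<close> is bounded below by the tangent at
  the mean of \<open>f\<close>.\<close>

lemma (in finite_measure) chord_gap_excess: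
  fixes f :: "'a \<Rightarrow> real"
  assumes int: "integrable M f" "integrable M (\<lambda>x. f x powr p)" and f0: "\<And>x. 0 \<le> f x"
    and Q: "Q \<in> sets M" "measure M (space M) \<le> N * measure M Q"
      "A * measure M Q < (\<integral>x. indicator Q x * f x \<partial>M)"
    and mean: "(\<integral>x. f x \<partial>M) \<le> A * measure M (space M)"
    and rh: "(\<integral>x. f x powr p \<partial>M)
      \<le> c * measure M (space M) * ((\<integral>x. f x \<partial>M) / measure M (space M)) powr p"
    and par: "0 \<le> \<eta>" "\<eta> < A" "1 < p" "1 \<le> c" "0 \<le> N"
  shows "(\<integral>x. indicator {x. \<eta> < f x} x *
      (chord_gap p \<eta> A (f x) - (c - 1) * N * A powr p * (f x - \<eta>)) \<partial>M) \<le> 0"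
proof -
  let ?m = "measure M (space M)"
  define a where "a = (\<integral>x. f x \<partial>M) / ?m"
  define S where "S = Q \<union> {x \<in> space M. A < f x}"
  have [measurable]: "f \<in> borel_measurable M" "Q \<in> sets M" using int Q by auto
  have [measurable]: "S \<in> sets M" unfolding S_def by measurable
  have QS: "Q \<subseteq> space M" using Q(1) by (rule sets.sets_into_space)
  have intA: "integrable M (\<lambda>x. f x - A)" using int by auto
  have intb: "integrable M (\<lambda>x. g x * F x)"
    if "g \<in> borel_measurable M" "integrable M F" "\<And>x. 0 \<le> g x \<and> g x \<le> 1" for g F :: "'a \<Rightarrow> real"
  proof (rule Bochner_Integration.integrable_bound[OF that(2)])
    show "(\<lambda>x. g x * F x) \<in> borel_measurable M" using that(1,2) by auto
    show "AE x in M. norm (g x * F x) \<le> norm (F x)"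
      using that(3) by (intro AE_I2) (auto simp: abs_mult intro!: mult_left_le_one_le)
  qed
  \<comment> \<open>On a space of measure \<open>0\<close> both sides of the strict inequality for
    \<open>Q\<close> would vanish.\<close>
  have m0: "0 < ?m"
  proof (rule ccontr)
    assume "\<not> 0 < ?m"
    then have "?m = 0" using measure_nonneg[of M "space M"] by linarith
    then have "AE x in M. indicator Q x * f x = (0::real)"
      by (intro AE_I[of _ _ "space M"]) (auto simp: emeasure_eq_measure)
    then have "(\<integral>x. indicator Q x * f x \<partial>M) = 0" by (rule integral_eq_zero_AE)
    moreover have "measure M Q = 0"
      using \<open>?m = 0\<close> QS by (metis bounded_measure measure_nonneg order_antisym)
    ultimately show False using Q(3) by simp
  qed
  \<comment> \<open>\<open>s\<close> is the excess of \<open>f\<close> over \<open>A\<close> on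
    \<open>S\<close>, and \<open>r\<close> is the deficit off \<open>S\<close>. The excess is
    positive because of \<open>Q\<close>, and since the mean of \<open>f\<close> is at most
    \<open>A\<close>, the deficit is at least as large.\<close>
  define s where "s = (\<integral>x. indicator S x * (f x - A) \<partial>M)"
  define r where "r = (\<integral>x. (1 - indicator S x) * (A - f x) \<partial>M)"
  have i1: "integrable M (\<lambda>x. indicator S x * (f x - A))" "integrable M (\<lambda>x. indicator Q x * (f x - A))"
    "integrable M (\<lambda>x. indicator Q x * f x)"
    by (intro intb intA int; auto simp: indicator_def)+
  have i2: "integrable M (\<lambda>x. (1 - indicator S x) * (f x - A))"
    by (intro intb intA int; auto simp: indicator_def)
  have i2': "integrable M (\<lambda>x. (1 - indicator S x) * (A - f x))"
    using int by (intro intb) (auto simp: indicator_def)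
  have "(\<integral>x. indicator Q x * (f x - A) \<partial>M) = (\<integral>x. indicator Q x * f x - A * indicator Q x \<partial>M)"
    by (rule Bochner_Integration.integral_cong) (auto simp: algebra_simps)
  also have "\<dots> = (\<integral>x. indicator Q x * f x \<partial>M) - A * measure M Q"
    using i1(3) QS by (subst Bochner_Integration.integral_diff) (auto simp: emeasure_eq_measure Int_absorb2)
  finally have "0 < (\<integral>x. indicator Q x * (f x - A) \<partial>M)" using Q(3) by simp
  also have "\<dots> \<le> s"
    unfolding s_def by (intro integral_mono i1) (auto simp: S_def indicator_def)
  finally have s0: "0 < s" .
  have "s - r = (\<integral>x. indicator S x * (f x - A) - (1 - indicator S x) * (A - f x) \<partial>M)"
    unfolding s_def r_def using i1(1) i2'
    by (subst Bochner_Integration.integral_diff) auto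
  also have "\<dots> = (\<integral>x. f x - A \<partial>M)"
    by (rule Bochner_Integration.integral_cong) (auto simp: algebra_simps)
  also have "\<dots> \<le> 0" using mean int by (simp add: mult.commute)
  finally have rs: "s \<le> r" by simp
  \<comment> \<open>With this constant off \<open>S\<close> the weighted deficit cancels the excess;
    it lies in \<open>[0,1]\<close> because \<open>0 < s \<le> r\<close>.\<close>
  define \<theta> where "\<theta> = s / r"
  have \<theta>: "0 \<le> \<theta>" "\<theta> \<le> 1" "s = \<theta> * r" using rs s0 by (auto simp: \<theta>_def)
  define w :: "'a \<Rightarrow> real" where "w x = indicator S x + \<theta> * (1 - indicator S x)" for x
  have w01: "0 \<le> w x" "w x \<le> 1" for x using \<theta> by (auto simp: w_def indicator_def)
  have wm[measurable]: "w \<in> borel_measurable M" unfolding w_def by measurable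
  define W where "W = (\<integral>x. w x \<partial>M)"
  have iw: "integrable M w" using intb[OF wm, of "\<lambda>_. 1"] w01 by simp
  have iwf: "integrable M (\<lambda>x. w x * f x)" "integrable M (\<lambda>x. w x * f x powr p)"
    using intb[OF wm int(1)] intb[OF wm int(2)] w01 by auto
  have "(\<integral>x. w x * (f x - A) \<partial>M) = (\<integral>x. indicator S x * (f x - A) + \<theta> * ((1 - indicator S x) * (f x - A)) \<partial>M)"
    by (rule Bochner_Integration.integral_cong) (auto simp: w_def algebra_simps)
  also have "\<dots> = s + \<theta> * (\<integral>x. (1 - indicator S x) * (f x - A) \<partial>M)"
    unfolding s_def using i1(1) i2 by (subst Bochner_Integration.integral_add) auto
  also have "(\<integral>x. (1 - indicator S x) * (f x - A) \<partial>M) = - r"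
    unfolding r_def Bochner_Integration.integral_minus[symmetric]
    by (rule Bochner_Integration.integral_cong) (auto simp: algebra_simps)
  finally have "(\<integral>x. w x * (f x - A) \<partial>M) = 0" using \<theta> by simp
  then have wf: "(\<integral>x. w x * f x \<partial>M) = A * W"
    using iw iwf by (simp add: W_def algebra_simps)
  \<comment> \<open>\<open>w\<close> is \<open>1\<close> on \<open>Q\<close>, so the total weight is
    at least the measure of the child.\<close>
  have NW: "?m \<le> N * W"
  proof -
    have "measure M Q = (\<integral>x. indicator Q x \<partial>M)" using QS by (simp add: Int_absorb2)
    also have "\<dots> \<le> W" unfolding W_def
    proof (rule integral_mono)
      show "integrable M (indicator Q :: 'a \<Rightarrow> real)" by (simp add: emeasure_eq_measure)
      show "indicator Q x \<le> w x" for x using \<theta> by (auto simp: w_def S_def indicator_def)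
    qed (rule iw)
    finally show ?thesis using Q(2) par(5) by (meson mult_left_mono order_trans)
  qed
  have W0: "0 \<le> W" unfolding W_def by (intro Bochner_Integration.integral_nonneg w01)
  \<comment> \<open>The mean \<open>a\<close> serves as base point of a tangent, so it has to be
    positive; it inherits this from the integral over \<open>Q\<close>.\<close>
  have "A * measure M Q \<ge> 0" using par by simp
  then have "0 < (\<integral>x. indicator Q x * f x \<partial>M)" using Q(3) by linarith
  also have "\<dots> \<le> (\<integral>x. f x \<partial>M)"
    using f0 by (intro integral_mono i1 int) (auto simp: indicator_def)
  finally have a0: "0 < a" using m0 by (simp add: a_def)
  have am: "(\<integral>x. f x \<partial>M) = a * ?m" using m0 by (simp add: a_def)
  have aA: "a \<le> A" using mean m0 by (simp add: am)
  let ?d = "p * a powr (p - 1)"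
  \<comment> \<open>The bracket is \<open>1 - w x\<close> times the tangent at \<open>a\<close>,
    expanded so that it can be integrated term by term.\<close>
  have "(\<integral>x. w x * f x powr p \<partial>M)
    \<le> (\<integral>x. f x powr p - (a powr p - ?d * a - a powr p * w x + ?d * a * w x + ?d * f x - ?d * (w x * f x)) \<partial>M)"
  proof (rule integral_mono)
    fix x
    have "0 \<le> (1 - w x) * (f x powr p - (a powr p + ?d * (f x - a)))"
      using w01 powr_tangent_le[OF a0 f0 par(3), of x] by simp
    then show "w x * f x powr p \<le> f x powr p - (a powr p - ?d * a - a powr p * w x + ?d * a * w x + ?d * f x - ?d * (w x * f x))"
      by (simp add: algebra_simps)
  qed (use iw iwf int in auto)
  also have "\<dots> = (\<integral>x. f x powr p \<partial>M) - (a powr p * ?m - ?d * a * ?m - a powr p * W + ?d * a * W + ?d * (a * ?m) - ?d * (A * W))"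
    using iw iwf int by (simp add: am wf W_def) (simp add: algebra_simps)
  also have "\<dots> \<le> c * ?m * a powr p - (a powr p * ?m - ?d * a * ?m - a powr p * W + ?d * a * W + ?d * (a * ?m) - ?d * (A * W))"
    using rh by (simp add: a_def)
  also have "\<dots> = (c - 1) * ?m * a powr p + W * (a powr p + ?d * (A - a))"
    by (simp add: algebra_simps)
  \<comment> \<open>The weighted mean being \<open>A\<close>, the factor of \<open>W\<close> is the
    tangent at \<open>a\<close> evaluated in \<open>A\<close>, hence at most
    \<open>A powr p\<close>. The other term grows because \<open>a \<le> A\<close>.\<close>
  also have "\<dots> \<le> (c - 1) * ?m * A powr p + W * A powr p"
    using par a0 aA W0 m0
    by (intro add_mono mult_left_mono powr_mono2 powr_tangent_le mult_nonneg_nonneg) auto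
  finally have wp: "(\<integral>x. w x * f x powr p \<partial>M) \<le> (c - 1) * ?m * A powr p + W * A powr p" .
  have up: "(\<integral>x. w x * f x powr p \<partial>M) - A powr p * W \<le> (c - 1) * N * A powr p * W"
  proof -
    have "(c - 1) * ?m * A powr p \<le> (c - 1) * (N * W) * A powr p"
      using NW par by (intro mult_right_mono mult_left_mono) auto
    then show ?thesis using wp by (simp add: algebra_simps)
  qed
  let ?i = "indicator {x. \<eta> < f x} :: 'a \<Rightarrow> real"
  let ?K = "(c - 1) * N * A powr p"
  have K0: "0 \<le> ?K" using par by simp
  have im: "?i \<in> borel_measurable M" by measurable
  have ig: "integrable M (\<lambda>x. chord_gap p \<eta> A (f x))"
    unfolding chord_gap_def using int by auto
  \<comment> \<open>Replacing the indicator by \<open>w\<close> only increases the gap term: between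
    \<open>\<eta>\<close> and \<open>A\<close> the gap is at most \<open>0\<close> and
    \<open>w \<le> 1\<close>; up to \<open>\<eta>\<close> it is at least \<open>0\<close>; above
    \<open>A\<close> both weights are \<open>1\<close>. The linear term \<open>f - \<eta>\<close>
    behaves in the opposite way, which suits its negative coefficient.\<close>
  have g1: "?i x * chord_gap p \<eta> A (f x) \<le> w x * chord_gap p \<eta> A (f x)" if "x \<in> space M" for x
  proof -
    consider "A < f x" | "\<eta> < f x" "f x \<le> A" | "f x \<le> \<eta>" by linarith
    then show ?thesis
    proof cases
      case 1
      then have "w x = 1" "?i x = 1" using that par by (auto simp: w_def S_def)
      then show ?thesis by simp
    next
      case 2
      then have "chord_gap p \<eta> A (f x) \<le> 0" using par by (intro chord_gap_nonpos) auto
      then show ?thesis using 2 w01[of x] by (simp add: mult_le_cancel_right1)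
    next
      case 3
      then have "0 \<le> chord_gap p \<eta> A (f x)" using par f0 by (intro chord_gap_nonneg) auto
      then show ?thesis using 3 w01[of x] by simp
    qed
  qed
  have g2: "w x * (f x - \<eta>) \<le> ?i x * (f x - \<eta>)" for x
    using w01[of x] by (auto simp: indicator_def mult_le_cancel_right1 mult_nonneg_nonpos)
  have "(\<integral>x. ?i x * (chord_gap p \<eta> A (f x) - ?K * (f x - \<eta>)) \<partial>M)
    \<le> (\<integral>x. w x * chord_gap p \<eta> A (f x) - ?K * (w x * (f x - \<eta>)) \<partial>M)"
  proof (rule integral_mono)
    show "integrable M (\<lambda>x. ?i x * (chord_gap p \<eta> A (f x) - ?K * (f x - \<eta>)))"
      using ig int by (intro intb im) (auto simp: indicator_def)
    show "integrable M (\<lambda>x. w x * chord_gap p \<eta> A (f x) - ?K * (w x * (f x - \<eta>)))"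
      using ig int w01 by (intro Bochner_Integration.integrable_diff integrable_mult_right intb wm) auto
    show "?i x * (chord_gap p \<eta> A (f x) - ?K * (f x - \<eta>))
        \<le> w x * chord_gap p \<eta> A (f x) - ?K * (w x * (f x - \<eta>))" if "x \<in> space M" for x
      using g1[OF that] mult_left_mono[OF g2[of x] K0] by (simp add: algebra_simps)
  qed
  also have "\<dots> = (\<integral>x. (A - \<eta>) * (w x * f x powr p) - (A - \<eta>) * A powr p * w x - (A powr p - \<eta> powr p) * (w x * f x)
      + (A powr p - \<eta> powr p) * A * w x - ?K * (w x * f x) + ?K * \<eta> * w x \<partial>M)"
    by (rule Bochner_Integration.integral_cong) (auto simp: chord_gap_def algebra_simps)
  also have "\<dots> = (A - \<eta>) * (\<integral>x. w x * f x powr p \<partial>M) - (A - \<eta>) * A powr p * W - (A powr p - \<eta> powr p) * (A * W)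
      + (A powr p - \<eta> powr p) * A * W - ?K * (A * W) + ?K * \<eta> * W"
    using iw iwf by (simp add: wf W_def)
  \<comment> \<open>The weighted mean is exactly \<open>A\<close>, so the linear part of the gap
    integrates to \<open>0\<close> and \<open>A - \<eta>\<close> factors out.\<close>
  also have "\<dots> = (A - \<eta>) * ((\<integral>x. w x * f x powr p \<partial>M) - A powr p * W - ?K * W)"
    by (simp add: algebra_simps)
  also have "\<dots> \<le> 0" using up par by (intro mult_nonneg_nonpos) auto
  finally show ?thesis .
qed

section \<open>Dyadic cells\<close>

text \<open>Half-open dyadic cubes, so that the cells of a fixed level partition the space.\<close>

definition dcell :: "nat \<Rightarrow> real ^ 'n::finite \<Rightarrow> (real ^ 'n) set" where
  "dcell k x = {y. \<forall>i. \<lfloor>2 ^ k * y $ i\<rfloor> = \<lfloor>2 ^ k * x $ i\<rfloor>}"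

lemma dcell_self [simp]: "x \<in> dcell k x"
  by (simp add: dcell_def)

lemma dcell_eq: "y \<in> dcell k x \<Longrightarrow> dcell k y = dcell k x"
  by (auto simp: dcell_def)

text \<open>Going to a coarser level drops the last \<open>k - j\<close> binary digits; the nesting
  of the cells rests on this.\<close>

lemma floor_power2_le:
  assumes "j \<le> k"
  shows "\<lfloor>2 ^ j * (x::real)\<rfloor> = \<lfloor>2 ^ k * x\<rfloor> div 2 ^ (k - j)"
proof -
  have "2 ^ k * x / 2 ^ (k - j) = 2 ^ j * x"
    using assms by (simp add: field_simps flip: power_add)
  then show ?thesis
    using floor_divide_real_eq_div[of "2 ^ (k - j)" "2 ^ k * x"] by simp
qed

lemma dcell_mono: "j \<le> k \<Longrightarrow> dcell k x \<subseteq> dcell j x"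
  unfolding dcell_def by (clarsimp simp: floor_power2_le)

text \<open>The closed companion of the cell, since \<open>dyadic_subcube\<close> speaks of closed
  boxes.\<close>

definition dcube :: "nat \<Rightarrow> real ^ 'n::finite \<Rightarrow> (real ^ 'n) set" where
  "dcube k x = cbox (\<chi> i. \<lfloor>2 ^ k * x $ i\<rfloor> / 2 ^ k) (\<chi> i. (\<lfloor>2 ^ k * x $ i\<rfloor> + 1) / 2 ^ k)"

lemma dcell_subset_dcube: "dcell k x \<subseteq> dcube k x"
proof
  fix y assume y: "y \<in> dcell k x"
  show "y \<in> dcube k x"
    unfolding dcube_def mem_box_cart
  proof
    fix i
    have "\<lfloor>2 ^ k * y $ i\<rfloor> = \<lfloor>2 ^ k * x $ i\<rfloor>" using y by (simp add: dcell_def)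
    moreover have "of_int \<lfloor>2 ^ k * y $ i\<rfloor> \<le> 2 ^ k * y $ i" "2 ^ k * y $ i \<le> of_int \<lfloor>2 ^ k * y $ i\<rfloor> + 1"
      by linarith+
    ultimately show "(\<chi> i. \<lfloor>2 ^ k * x $ i\<rfloor> / 2 ^ k) $ i \<le> y $ i \<and>
        y $ i \<le> (\<chi> i. (\<lfloor>2 ^ k * x $ i\<rfloor> + 1) / 2 ^ k) $ i"
      by (simp add: field_simps)
  qed
qed

lemma box_subset_dcell:
  "box (\<chi> i. \<lfloor>2 ^ k * x $ i\<rfloor> / 2 ^ k) (\<chi> i. (\<lfloor>2 ^ k * x $ i\<rfloor> + 1) / 2 ^ k) \<subseteq> dcell k x"
proof
  fix y assume y: "y \<in> box (\<chi> i. \<lfloor>2 ^ k * x $ i\<rfloor> / 2 ^ k) (\<chi> i. (\<lfloor>2 ^ k * x $ i\<rfloor> + 1) / 2 ^ k)"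
  have "\<lfloor>2 ^ k * y $ i\<rfloor> = \<lfloor>2 ^ k * x $ i\<rfloor>" for i
  proof -
    have "\<lfloor>2 ^ k * x $ i\<rfloor> / 2 ^ k < y $ i" "y $ i < (\<lfloor>2 ^ k * x $ i\<rfloor> + 1) / 2 ^ k"
      using y by (auto simp: mem_box_cart)
    then have "of_int \<lfloor>2 ^ k * x $ i\<rfloor> < 2 ^ k * y $ i" "2 ^ k * y $ i < of_int \<lfloor>2 ^ k * x $ i\<rfloor> + 1"
      by (auto simp: field_simps)
    then show ?thesis by linarith
  qed
  then show "y \<in> dcell k x" by (simp add: dcell_def)
qed

text \<open>The cell lies between the open box and the closed cube, so the difference is part of a
  frontier.\<close>

lemma dcell_null: "dcube k x - dcell k x \<in> null_sets lebesgue"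
proof -
  have "negligible (dcube k x - dcell k x)"
    using box_subset_dcell[of k x] unfolding dcube_def
    by (intro negligible_subset[OF negligible_frontier_interval]) auto
  then show ?thesis by (simp add: negligible_iff_null_sets)
qed

lemma sets_dcell [measurable, simp]: "dcell k x \<in> sets lebesgue"
proof -
  have "dcell k x = dcube k x - (dcube k x - dcell k x)"
    using dcell_subset_dcube by auto
  also have "\<dots> \<in> sets lebesgue"
    by (rule sets.Diff[OF _ null_setsD2[OF dcell_null]]) (simp add: dcube_def)
  finally show ?thesis .
qed

lemma emeasure_dcell_dcube: "emeasure lebesgue (dcell k x) = emeasure lebesgue (dcube k x)"
proof -
  have "dcell k x \<union> (dcube k x - dcell k x) = dcube k x"
    using dcell_subset_dcube by auto
  then show ?thesis
    using emeasure_Un_null_set[OF sets_dcell dcell_null, of k x k x] by simp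
qed

lemma measure_dcell: "measure lebesgue (dcell k (x :: real ^ 'n::finite)) = 1 / 2 ^ (k * CARD('n))"
proof -
  let ?a = "(\<chi> i. \<lfloor>2 ^ k * x $ i\<rfloor> / 2 ^ k) :: real ^ 'n"
  let ?b = "(\<chi> i. (\<lfloor>2 ^ k * x $ i\<rfloor> + 1) / 2 ^ k) :: real ^ 'n"
  have "measure lebesgue (dcell k x) = measure lborel (dcube k x)"
    unfolding measure_def emeasure_dcell_dcube by (simp add: dcube_def)
  also have "\<dots> = (\<Prod>i\<in>UNIV. ?b $ i - ?a $ i)"
  proof -
    have "x \<in> cbox ?a ?b" using dcell_subset_dcube[of k x] by (auto simp: dcube_def)
    then show ?thesis unfolding dcube_def by (subst content_cbox_cart) auto
  qed
  also have "\<dots> = (\<Prod>i\<in>(UNIV::'n set). 1 / 2 ^ k)"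
    by (intro prod.cong) (auto simp: field_simps)
  also have "\<dots> = 1 / 2 ^ (k * CARD('n))"
    by (simp add: power_mult power_one_over)
  finally show ?thesis .
qed

lemma emeasure_dcell: "emeasure lebesgue (dcell k (x :: real ^ 'n::finite)) = ennreal (1 / 2 ^ (k * CARD('n)))"
proof -
  have "emeasure lebesgue (dcell k x) \<noteq> \<infinity>"
    unfolding emeasure_dcell_dcube by (simp add: dcube_def emeasure_lborel_cbox_finite[unfolded infinity_ennreal_def, THEN less_imp_neq])
  then show ?thesis by (simp add: emeasure_eq_ennreal_measure measure_dcell)
qed

lemma dcell_subset_unit:
  assumes "\<And>i. 0 \<le> x $ i \<and> x $ i < 1" "y \<in> dcell k x"
  shows "0 \<le> y $ i \<and> y $ i < 1"
proof -
  have "y \<in> dcell 0 x" using assms dcell_mono[of 0 k x] by auto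
  then have "\<lfloor>y $ i\<rfloor> = \<lfloor>x $ i\<rfloor>" by (simp add: dcell_def)
  moreover have "\<lfloor>x $ i\<rfloor> = 0" using assms(1)[of i] by (simp add: floor_eq_iff)
  ultimately show ?thesis by (simp add: floor_eq_iff)
qed

lemma dcell_subset_open:
  fixes x :: "real ^ 'n::finite"
  assumes "open U" "x \<in> U"
  obtains k where "dcell k x \<subseteq> U"
proof -
  obtain e where e: "0 < e" "ball x e \<subseteq> U" using assms open_contains_ball by blast
  \<comment> \<open>Two points of a cell of level \<open>k\<close> differ by at most
    \<open>1 / 2 ^ k\<close> in each coordinate, so their distance is at most
    \<open>CARD('n) / 2 ^ k\<close>.\<close>
  obtain k :: nat where k: "real CARD('n) / e < 2 ^ k"
    using real_arch_pow[of 2] by auto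
  have "dcell k x \<subseteq> ball x e"
  proof
    fix y assume y: "y \<in> dcell k x"
    have "\<bar>(x - y) $ i\<bar> \<le> 1 / 2 ^ k" for i
    proof -
      have "\<lfloor>2 ^ k * y $ i\<rfloor> = \<lfloor>2 ^ k * x $ i\<rfloor>" using y by (simp add: dcell_def)
      then have "\<bar>2 ^ k * x $ i - 2 ^ k * y $ i\<bar> \<le> 1" by linarith
      then have "2 ^ k * \<bar>x $ i - y $ i\<bar> \<le> 1"
        by (simp add: abs_mult flip: right_diff_distrib)
      then show ?thesis by (simp add: field_simps)
    qed
    then have "norm (x - y) \<le> (\<Sum>i\<in>(UNIV::'n set). 1 / 2 ^ k)"
      by (intro order_trans[OF norm_le_l1_cart] sum_mono)
    also have "\<dots> < e" using k e by (simp add: field_simps)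
    finally show "y \<in> ball x e" by (simp add: dist_norm)
  qed
  with e that show thesis by blast
qed

section \<open>Decomposition into maximal cells\<close>

lemma countable_dcells: "countable {dcell k x |k x. True}"
proof -
  have "{dcell k x |k x. True} \<subseteq>
      range (\<lambda>(k, m :: int ^ 'a). {y :: real ^ 'a. \<forall>i. \<lfloor>2 ^ k * y $ i\<rfloor> = m $ i})"
  proof clarify
    fix k and x :: "real ^ 'a"
    show "dcell k x \<in> range (\<lambda>(k, m :: int ^ 'a). {y :: real ^ 'a. \<forall>i. \<lfloor>2 ^ k * y $ i\<rfloor> = m $ i})"
      by (intro range_eqI[of _ _ "(k, \<chi> i. \<lfloor>2 ^ k * x $ i\<rfloor>)"]) (simp add: dcell_def)
  qed
  then show ?thesis by (rule countable_subset) auto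
qed

text \<open>Only maximal cells of the family are used; two of them are equal or disjoint.\<close>

lemma integral_nonpos_by_cells:
  fixes g :: "real ^ 'n::finite \<Rightarrow> real" and G :: "nat \<Rightarrow> real ^ 'n \<Rightarrow> bool"
  assumes g: "integrable lebesgue g"
    and G: "\<And>k x y. y \<in> dcell k x \<Longrightarrow> G k x \<Longrightarrow> G k y"
    and cell: "\<And>k x. G k x \<Longrightarrow> (LINT y:dcell k x|lebesgue. g y) \<le> 0"
    and off: "AE x in lebesgue. (\<forall>k. \<not> G k x) \<longrightarrow> g x \<le> 0"
  shows "(LINT x|lebesgue. g x) \<le> 0"
proof -
  define F where "F = {dcell k x |k x. G k x \<and> (\<forall>j<k. \<not> G j x)}"
  have cF: "countable F"
    by (rule countable_subset[OF _ countable_dcells]) (auto simp: F_def)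
  have disj: "P = P'" if PF: "P \<in> F" "P' \<in> F" and z: "z \<in> P" "z \<in> P'" for P P' z
  proof -
    obtain k x where P: "P = dcell k x" "G k x" "\<And>j. j < k \<Longrightarrow> \<not> G j x"
      using PF by (auto simp: F_def)
    obtain l y where P': "P' = dcell l y" "G l y" "\<And>j. j < l \<Longrightarrow> \<not> G j y"
      using PF by (auto simp: F_def)
    have x: "x \<in> dcell k z" and y: "y \<in> dcell l z"
      using z P P' by (auto simp: dcell_def)
    have zG: "G k z" "G l z"
      using G[OF _ P(2)] G[OF _ P'(2)] z P P' by auto
    \<comment> \<open>Otherwise \<open>y\<close> lies in the coarser cell around \<open>z\<close>
      and satisfies \<open>G\<close> at level \<open>k\<close>, before its first level
      \<open>l\<close>.\<close>
    have "\<not> k < l"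
    proof
      assume "k < l"
      then have "y \<in> dcell k z" using y dcell_mono[of k l z] by auto
      then have "G k y" using G zG by blast
      then show False using P'(3) \<open>k < l\<close> by blast
    qed
    moreover have "\<not> l < k"
    proof
      assume "l < k"
      then have "x \<in> dcell l z" using x dcell_mono[of l k z] by auto
      then have "G l x" using G zG by blast
      then show False using P(3) \<open>l < k\<close> by blast
    qed
    ultimately have "k = l" by simp
    then show ?thesis using dcell_eq[of z k x] dcell_eq[of z l y] z P P' by simp
  qed
  \<comment> \<open>\<open>F\<close> becomes a sequence of disjoint sets: each \<open>A i\<close> is
    one member of \<open>F\<close>, or empty if the index \<open>i\<close> is not taken.\<close>
  define A where "A i = \<Union>{P \<in> F. to_nat_on F P = i}" for i
  have A: "A i = {} \<or> A i \<in> F" for i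
  proof (cases "\<exists>P\<in>F. to_nat_on F P = i")
    case True
    then obtain P where "P \<in> F" "to_nat_on F P = i" by auto
    then have "{P \<in> F. to_nat_on F P = i} = {P}"
      using inj_on_to_nat_on[OF cF] by (auto simp: inj_on_def)
    then show ?thesis using \<open>P \<in> F\<close> by (simp add: A_def)
  next
    case False
    then show ?thesis by (auto simp: A_def)
  qed
  have Acell: "A i = {} \<or> (\<exists>k x. A i = dcell k x \<and> G k x)" for i
    using A[of i] by (auto simp: F_def)
  have Am: "A i \<in> sets lebesgue" for i using Acell[of i] by auto
  have Ad: "A i \<inter> A j = {}" if "i \<noteq> j" for i j
  proof (rule ccontr)
    assume "A i \<inter> A j \<noteq> {}"
    then obtain z P P' where "z \<in> P" "z \<in> P'" "P \<in> F" "P' \<in> F" "to_nat_on F P = i" "to_nat_on F P' = j"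
      by (auto simp: A_def)
    then show False using disj that by metis
  qed
  have UA: "x \<in> (\<Union>i. A i)" if "G k x" for k x
  proof -
    define l where "l = (LEAST l. G l x)"
    have "G l x" unfolding l_def using that by (rule LeastI)
    moreover have "\<forall>j<l. \<not> G j x" unfolding l_def using not_less_Least by blast
    ultimately have "dcell l x \<in> F" by (auto simp: F_def)
    then show ?thesis by (auto simp: A_def intro!: bexI[of _ "dcell l x"])
  qed
  have Um: "(\<Union>i. A i) \<in> sets lebesgue" using Am by auto
  have gU: "set_integrable lebesgue (\<Union>i. A i) g"
    unfolding set_integrable_def using Um g by (intro integrable_mult_indicator)
  have gi: "set_integrable lebesgue (A i) g" for i
    unfolding set_integrable_def using Am g by (intro integrable_mult_indicator)
  \<comment> \<open>By \<open>UA\<close> no \<open>G k x\<close> holds off the union, so the part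
    discarded there is at most \<open>0\<close> by \<open>off\<close>.\<close>
  have "(LINT x|lebesgue. g x) \<le> (LINT x:(\<Union>i. A i)|lebesgue. g x)"
    unfolding set_lebesgue_integral_def
  proof (rule integral_mono_AE)
    show "AE x in lebesgue. g x \<le> indicat_real (\<Union> (range A)) x *\<^sub>R g x"
      using off
    proof (rule AE_mp, intro AE_I2 impI)
      fix x assume "(\<forall>k. \<not> G k x) \<longrightarrow> g x \<le> 0"
      then show "g x \<le> indicat_real (\<Union> (range A)) x *\<^sub>R g x"
        using UA[of _ x] by (auto simp: indicator_def)
    qed
  qed (use g gU in \<open>auto simp: set_integrable_def\<close>)
  \<comment> \<open>The integral over the union is the limit of those over finite subunions, which
    are sums of nonpositive terms.\<close>
  also have "\<dots> \<le> 0"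
  proof (rule LIMSEQ_le_const2)
    have U: "(\<Union>n. \<Union>i<n. A i) = (\<Union>i. A i)" by auto
    show "(\<lambda>n. LINT x:(\<Union>i<n. A i)|lebesgue. g x) \<longlonglongrightarrow> (LINT x:(\<Union>i. A i)|lebesgue. g x)"
      using set_integral_cont_up[of "\<lambda>n. \<Union>i<n. A i" lebesgue g] Am gU
      unfolding U by (auto simp: incseq_def intro: less_le_trans)
    have "(LINT x:(\<Union>i<n. A i)|lebesgue. g x) = (\<Sum>i<n. LINT x:A i|lebesgue. g x)" for n
      using Ad gi Am by (intro set_integral_finite_Union) (auto simp: disjoint_family_on_def)
    moreover have "(LINT x:(A i)|lebesgue. g x) \<le> 0" for i
      using Acell[of i] cell by (auto simp: set_lebesgue_integral_def)
    ultimately show "\<exists>N. \<forall>n\<ge>N. (LINT x:(\<Union>i<n. A i)|lebesgue. g x) \<le> 0"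
      by (auto intro!: sum_nonpos)
  qed
  finally show ?thesis .
qed

text \<open>In each coordinate the parity of the floor at level \<open>Suc k\<close> tells which
  half \<open>bisect\<close> takes. At level \<open>0\<close> the bound \<open>x $ i < 1\<close>
  makes every floor \<open>0\<close>.\<close>

lemma dyadic_subcube_dcube:
  fixes x :: "real ^ 'n::finite"
  assumes "\<And>i. 0 \<le> x $ i \<and> x $ i < 1"
  shows "dyadic_subcube (dcube k x)"
proof (induction k)
  case 0
  have "\<lfloor>x $ i\<rfloor> = 0" for i using assms[of i] by (simp add: floor_eq_iff)
  then have "dcube 0 x = cbox 0 1"
    by (simp add: dcube_def zero_vec_def one_vec_def)
  then show ?case using dyadic_subcube.whole by simp
next
  case (Suc k)
  show ?case
    unfolding dcube_def
  proof (rule dyadic_subcube.bisect)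
    show "dyadic_subcube (cbox (\<chi> i. \<lfloor>2 ^ k * x $ i\<rfloor> / 2 ^ k) (\<chi> i. (\<lfloor>2 ^ k * x $ i\<rfloor> + 1) / 2 ^ k))"
      using Suc by (simp add: dcube_def)
    fix i
    have q: "\<lfloor>2 ^ k * x $ i\<rfloor> = \<lfloor>2 ^ Suc k * x $ i\<rfloor> div 2"
      using floor_power2_le[of k "Suc k" "x $ i"] by simp
    consider "\<lfloor>2 ^ Suc k * x $ i\<rfloor> = 2 * \<lfloor>2 ^ k * x $ i\<rfloor>" | "\<lfloor>2 ^ Suc k * x $ i\<rfloor> = 2 * \<lfloor>2 ^ k * x $ i\<rfloor> + 1"
      unfolding q by linarith
    then show "(\<chi> i. \<lfloor>2 ^ Suc k * x $ i\<rfloor> / 2 ^ Suc k) $ i = (\<chi> i. \<lfloor>2 ^ k * x $ i\<rfloor> / 2 ^ k) $ i \<and>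
       (\<chi> i. (\<lfloor>2 ^ Suc k * x $ i\<rfloor> + 1) / 2 ^ Suc k) $ i =
         ((\<chi> i. \<lfloor>2 ^ k * x $ i\<rfloor> / 2 ^ k) $ i + (\<chi> i. (\<lfloor>2 ^ k * x $ i\<rfloor> + 1) / 2 ^ k) $ i) / 2 \<or>
       (\<chi> i. \<lfloor>2 ^ Suc k * x $ i\<rfloor> / 2 ^ Suc k) $ i =
         ((\<chi> i. \<lfloor>2 ^ k * x $ i\<rfloor> / 2 ^ k) $ i + (\<chi> i. (\<lfloor>2 ^ k * x $ i\<rfloor> + 1) / 2 ^ k) $ i) / 2 \<and>
       (\<chi> i. (\<lfloor>2 ^ Suc k * x $ i\<rfloor> + 1) / 2 ^ Suc k) $ i = (\<chi> i. (\<lfloor>2 ^ k * x $ i\<rfloor> + 1) / 2 ^ k) $ i"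
    proof cases
      case 1
      show ?thesis unfolding vec_lambda_beta 1 by (simp add: field_simps)
    next
      case 2
      show ?thesis unfolding vec_lambda_beta 2 by (simp add: field_simps)
    qed
  qed
qed

section \<open>Dyadic differentiation and stopping cubes\<close>

lemma integrable_indicator_times:
  "integrable M g \<Longrightarrow> A \<in> sets M \<Longrightarrow> integrable M (\<lambda>x. indicator A x * (g x :: real))"
  using integrable_mult_indicator[of A M g] by simp

text \<open>A one-sided Lebesgue differentiation theorem. Let \<open>S\<close> be the set where
  \<open>A < f\<close> although all cell means are at most \<open>A\<close>. Covering
  \<open>S\<close> by cells inside an open \<open>T\<close> bounds the integral of
  \<open>f - A\<close> over \<open>S\<close> by \<open>A\<close> times the measure of
  \<open>T - S\<close>, which can be made arbitrarily small.\<close>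

lemma AE_dyadic_mean_exceeds:
  fixes f :: "real ^ 'n::finite \<Rightarrow> real"
  assumes f: "integrable lebesgue f" and f0: "\<And>x. 0 \<le> f x" and A: "0 < A"
  shows "AE x in lebesgue. A < f x \<longrightarrow>
    (\<exists>k. A * measure lebesgue (dcell k x) < (LINT y:dcell k x|lebesgue. f y))"
proof -
  define low where "low k x \<longleftrightarrow> (LINT y:dcell k x|lebesgue. f y) \<le> A * measure lebesgue (dcell k x)" for k x
  define S where "S = {x. A < f x} \<inter> (\<Inter>k. {x. low k x})"
  have [measurable]: "f \<in> borel_measurable lebesgue" using f by auto
  have "{x. low k x} \<in> sets lebesgue" for k
  proof -
    \<comment> \<open>\<open>low k\<close> depends on the cell only, so the set in question is a
      countable union of cells.\<close>
    have "low k y" if "low k x" "y \<in> dcell k x" for x y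
      using that dcell_eq[of y k x] by (simp add: low_def)
    then have "{x. low k x} = \<Union>{dcell k x |x. low k x}" by (auto intro: dcell_self)
    moreover have "\<Union>{dcell k x |x. low k x} \<in> sets lebesgue"
      by (intro sets.countable_Union countable_subset[OF _ countable_dcells]) auto
    ultimately show ?thesis by simp
  qed
  moreover have "{x. A < f x} \<in> sets lebesgue"
    using borel_measurable_less[of "\<lambda>_. A" lebesgue f] by simp
  ultimately have S[measurable]: "S \<in> sets lebesgue" unfolding S_def by blast
  \<comment> \<open>Chebyshev's inequality: \<open>f / A\<close> exceeds \<open>1\<close> on
    \<open>S\<close>.\<close>
  have iS: "integrable lebesgue (\<lambda>x. indicator S x :: real)"
  proof (rule Bochner_Integration.integrable_bound[of lebesgue "\<lambda>x. f x / A"])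
    show "integrable lebesgue (\<lambda>x. f x / A)" using f by simp
    show "(\<lambda>x. indicator S x :: real) \<in> borel_measurable lebesgue"
      using S by (rule borel_measurable_indicator)
    have "norm (indicator S x :: real) \<le> norm (f x / A)" for x
      using A f0[of x] by (cases "x \<in> S") (auto simp: S_def field_simps)
    then show "AE x in lebesgue. norm (indicator S x :: real) \<le> norm (f x / A)" by simp
  qed
  have ifS: "integrable lebesgue (\<lambda>x. indicator S x * f x)"
    using f S by (rule integrable_indicator_times)
  have ifSA: "integrable lebesgue (\<lambda>x. indicator S x * (f x - A))"
    by (rule back_subst[of "integrable lebesgue", OF Bochner_Integration.integrable_diff[OF ifS integrable_mult_right[OF iS, of A]]])
      (auto simp: algebra_simps)
  have approx: "(LINT x|lebesgue. indicator S x * (f x - A)) \<le> A * e" if "0 < e" for e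
  proof -
    obtain T where T: "open T" "S \<subseteq> T" "T - S \<in> lmeasurable" "emeasure lebesgue (T - S) < ennreal e"
      using sets_lebesgue_outer_open[OF S \<open>0 < e\<close>] .
    have mT: "measure lebesgue (T - S) \<le> e"
      using T(3,4) that by (simp add: emeasure_eq_measure2 ennreal_less_iff)
    have iT: "integrable lebesgue (\<lambda>x. indicator (T - S) x :: real)"
      using T(3) by (intro integrable_real_indicator) (auto simp: fmeasurable_def)
    \<comment> \<open>On a cell inside \<open>T\<close> one has \<open>g \<le> f - A\<close>, and a cell that meets \<open>S\<close> has mean at most \<open>A\<close>.\<close>
    define g where "g x = indicator S x * (f x - A) - A * indicator (T - S) x" for x
    have g: "integrable lebesgue g"
      unfolding g_def using iT ifSA by auto
    have "(LINT x|lebesgue. g x) \<le> 0"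
    proof (rule integral_nonpos_by_cells[OF g, where G = "\<lambda>k x. dcell k x \<subseteq> T \<and> (\<exists>z\<in>S. z \<in> dcell k x)"])
      fix k x y assume "y \<in> dcell k x" "dcell k x \<subseteq> T \<and> (\<exists>z\<in>S. z \<in> dcell k x)"
      then show "dcell k y \<subseteq> T \<and> (\<exists>z\<in>S. z \<in> dcell k y)" using dcell_eq[of y k x] by simp
    next
      fix k x assume *: "dcell k x \<subseteq> T \<and> (\<exists>z\<in>S. z \<in> dcell k x)"
      then obtain z where "z \<in> S" "z \<in> dcell k x" by blast
      then have "low k z" "dcell k z = dcell k x" by (auto simp: S_def dcell_eq)
      then have "low k x" by (simp add: low_def)
      have ic: "integrable lebesgue (\<lambda>x'. indicator (dcell k x) x' :: real)"
        by (intro integrable_real_indicator) (auto simp: emeasure_dcell)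
      have "(LINT y:dcell k x|lebesgue. g y) \<le>
          (LINT y|lebesgue. indicator (dcell k x) y * f y - A * indicator (dcell k x) y)"
        unfolding set_lebesgue_integral_def
      proof (rule integral_mono)
        show "integrable lebesgue (\<lambda>y. indicat_real (dcell k x) y *\<^sub>R g y)"
          using integrable_indicator_times[OF g sets_dcell] by simp
        show "integrable lebesgue (\<lambda>y. indicat_real (dcell k x) y * f y - A * indicat_real (dcell k x) y)"
          using integrable_indicator_times[OF f sets_dcell] ic by auto
        show "indicat_real (dcell k x) y *\<^sub>R g y \<le> indicat_real (dcell k x) y * f y - A * indicat_real (dcell k x) y" for y
          using * f0[of y] by (auto simp: g_def indicator_def)
      qed
      also have "\<dots> = (LINT y:dcell k x|lebesgue. f y) - A * measure lebesgue (dcell k x)"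
        using integrable_indicator_times[OF f sets_dcell, of k x] ic
        by (simp add: set_lebesgue_integral_def)
      also have "\<dots> \<le> 0" using \<open>low k x\<close> by (simp add: low_def)
      finally show "(LINT y:dcell k x|lebesgue. g y) \<le> 0" .
    next
      show "AE x in lebesgue. (\<forall>k. \<not> (dcell k x \<subseteq> T \<and> (\<exists>z\<in>S. z \<in> dcell k x))) \<longrightarrow> g x \<le> 0"
      proof (intro AE_I2 impI)
        fix x assume *: "\<forall>k. \<not> (dcell k x \<subseteq> T \<and> (\<exists>z\<in>S. z \<in> dcell k x))"
        have "x \<notin> S"
        proof
          assume "x \<in> S"
          then obtain k where "dcell k x \<subseteq> T" using dcell_subset_open T(1,2) by blast
          then show False using * \<open>x \<in> S\<close> dcell_self by blast
        qed
        then show "g x \<le> 0" using A by (auto simp: g_def indicator_def)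
      qed
    qed
    moreover have "(LINT x|lebesgue. g x) = (LINT x|lebesgue. indicator S x * (f x - A)) - A * measure lebesgue (T - S)"
      unfolding g_def using iT ifSA by simp
    moreover have "A * measure lebesgue (T - S) \<le> A * e" using mT A by simp
    ultimately show ?thesis by linarith
  qed
  have le: "(LINT x|lebesgue. indicator S x * (f x - A)) \<le> 0 + e" if "0 < e" for e
    using approx[of "e / A"] A that by simp
  have nn: "0 \<le> indicator S x * (f x - A)" for x by (auto simp: S_def indicator_def)
  have "(LINT x|lebesgue. indicator S x * (f x - A)) = 0"
    using field_le_epsilon[OF le] nn by (intro antisym Bochner_Integration.integral_nonneg) auto
  \<comment> \<open>On \<open>S\<close> this function is positive, so its vanishing almost
    everywhere makes \<open>S\<close> a null set.\<close>
  then have "AE x in lebesgue. indicator S x * (f x - A) = 0"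
    using integral_nonneg_eq_0_iff_AE[OF ifSA] nn by simp
  then show ?thesis
  proof (rule AE_mp, intro AE_I2 impI)
    fix x assume *: "indicator S x * (f x - A) = 0" "A < f x"
    then have "x \<notin> S" by (auto simp: indicator_def)
    then show "\<exists>k. A * measure lebesgue (dcell k x) < (LINT y:dcell k x|lebesgue. f y)"
      using * by (auto simp: S_def low_def not_le)
  qed
qed

text \<open>Here \<open>chord_gap_excess\<close> is applied on each stopping cell and the results
  are combined by \<open>integral_nonpos_by_cells\<close>; a cell has \<open>2 ^ CARD('n)\<close>
  times the measure of its child.\<close>

lemma dyadic_chord_gap_excess:
  fixes f :: "real ^ 'n::finite \<Rightarrow> real"
  assumes int: "integrable lebesgue f" "integrable lebesgue (\<lambda>x. f x powr p)"
    and f0: "\<And>x. 0 \<le> f x" and supp: "\<And>x. x \<notin> unit_cube \<Longrightarrow> f x = 0"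
    and mean: "(LINT x|lebesgue. f x) \<le> A"
    and rh: "\<And>k x. (\<And>i. 0 \<le> x $ i \<and> x $ i < 1) \<Longrightarrow>
      (LINT y:dcell k x|lebesgue. f y powr p) \<le> c * measure lebesgue (dcell k x) *
        ((LINT y:dcell k x|lebesgue. f y) / measure lebesgue (dcell k x)) powr p"
    and par: "0 \<le> \<eta>" "\<eta> < A" "1 < p" "1 \<le> c"
  shows "(LINT x|lebesgue. indicator {x. \<eta> < f x} x *
      (chord_gap p \<eta> A (f x) - (c - 1) * 2 ^ CARD('n) * A powr p * (f x - \<eta>))) \<le> 0"
proof -
  \<comment> \<open>The child may belong to any point \<open>z\<close> of the cell, not just to
    \<open>x\<close>, so that \<open>G k\<close> takes the same value throughout a cell.\<close>
  define G where "G k x \<longleftrightarrow> (\<forall>i. 0 \<le> x $ i \<and> x $ i < 1) \<and>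
      (LINT y:dcell k x|lebesgue. f y) \<le> A * measure lebesgue (dcell k x) \<and>
      (\<exists>z\<in>dcell k x. A * measure lebesgue (dcell (Suc k) z) < (LINT y:dcell (Suc k) z|lebesgue. f y))"
    for k and x :: "real ^ 'n"
  let ?K = "(c - 1) * 2 ^ CARD('n) * A powr p"
  let ?g = "\<lambda>x. indicator {x. \<eta> < f x} x * (chord_gap p \<eta> A (f x) - ?K * (f x - \<eta>))"
  have [measurable]: "f \<in> borel_measurable lebesgue" using int by auto
  have K0: "0 \<le> ?K" using par by simp
  have P: "{x. \<eta> < f x} \<in> sets lebesgue"
    using borel_measurable_less[of "\<lambda>_. \<eta>" lebesgue f] by simp
  have I: "integrable lebesgue (\<lambda>x. indicator {x. \<eta> < f x} x :: real)"
  proof (rule Bochner_Integration.integrable_bound[of lebesgue "indicator unit_cube :: _ \<Rightarrow> real"])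
    show "AE x in lebesgue. norm (indicator {x. \<eta> < f x} x :: real) \<le> norm (indicator unit_cube x :: real)"
      using supp par(1) by (intro AE_I2) (force simp: indicator_def)
    show "(\<lambda>x. indicator {x. \<eta> < f x} x :: real) \<in> borel_measurable lebesgue"
      using P by (rule borel_measurable_indicator)
  qed (rule integrable_real_indicator; simp add: emeasure_lborel_cbox_finite[unfolded infinity_ennreal_def])
  have g: "integrable lebesgue ?g"
  proof -
    have "integrable lebesgue (\<lambda>x. (A - \<eta>) * (indicator {x. \<eta> < f x} x * f x powr p)
        - (A powr p - \<eta> powr p + ?K) * (indicator {x. \<eta> < f x} x * f x)
        + ((A powr p - \<eta> powr p) * A - (A - \<eta>) * A powr p + ?K * \<eta>) * indicator {x. \<eta> < f x} x)"
      by (intro Bochner_Integration.integrable_add Bochner_Integration.integrable_diff integrable_mult_right integrable_indicator_times int P I)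
    then show ?thesis
      by (rule back_subst[of "integrable lebesgue"]) (auto simp: chord_gap_def algebra_simps)
  qed
  show ?thesis
  proof (rule integral_nonpos_by_cells[OF g, where G = G])
    fix k x y assume "y \<in> dcell k x" "G k x"
    then show "G k y" using dcell_eq[of y k x] dcell_subset_unit[of x y k] unfolding G_def by simp
  next
    fix k x assume Gx: "G k x"
    then obtain z where z: "z \<in> dcell k x"
      "A * measure lebesgue (dcell (Suc k) z) < (LINT y:dcell (Suc k) z|lebesgue. f y)"
      by (auto simp: G_def)
    let ?M = "lebesgue_on (dcell k x)"
    have sub: "dcell (Suc k) z \<subseteq> dcell k x"
      using dcell_mono[of k "Suc k" z] dcell_eq[OF z(1)] by simp
    have int_on: "(\<integral>x. h x \<partial>?M) = (LINT y:dcell k x|lebesgue. h y)" for h :: "_ \<Rightarrow> real"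
      by (simp add: integral_restrict_space set_lebesgue_integral_def)
    have m: "measure ?M X = measure lebesgue X" if "X \<subseteq> dcell k x" for X
      using that by (simp add: measure_restrict_space)
    interpret finite_measure ?M
      by (rule finite_measureI) (simp add: emeasure_restrict_space emeasure_dcell)
    have "(\<integral>x. ?g x \<partial>?M) \<le> 0"
    proof (rule chord_gap_excess[where Q = "dcell (Suc k) z"])
      show "integrable ?M f" "integrable ?M (\<lambda>x. f x powr p)"
        using int integrable_indicator_times[OF _ sets_dcell] by (auto simp: integrable_restrict_space)
      show "dcell (Suc k) z \<in> sets ?M"
        using sub by (simp add: sets_restrict_space_iff)
      show "measure ?M (space ?M) \<le> 2 ^ CARD('n) * measure ?M (dcell (Suc k) z)"
        using sub by (simp add: m measure_dcell power_add)
      have "(\<integral>x. indicator (dcell (Suc k) z) x * f x \<partial>?M) = (LINT y:dcell (Suc k) z|lebesgue. f y)"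
        unfolding int_on set_lebesgue_integral_def using sub
        by (intro Bochner_Integration.integral_cong) (auto simp: indicator_def)
      then show "A * measure ?M (dcell (Suc k) z) < (\<integral>x. indicator (dcell (Suc k) z) x * f x \<partial>?M)"
        using z(2) sub by (simp add: m)
      show "(\<integral>x. f x \<partial>?M) \<le> A * measure ?M (space ?M)"
        using Gx by (simp add: G_def m int_on)
      show "(\<integral>x. f x powr p \<partial>?M) \<le> c * measure ?M (space ?M) * ((\<integral>x. f x \<partial>?M) / measure ?M (space ?M)) powr p"
        using Gx rh[of x k] by (simp add: G_def m int_on)
    qed (use par f0 in auto)
    then show "(LINT y:dcell k x|lebesgue. ?g y) \<le> 0" by (simp only: int_on)
  next
    \<comment> \<open>\<open>G\<close> demands \<open>x $ i < 1\<close>; the faces of the cube are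
      put aside as a null set.\<close>
    have "AE x in lebesgue. x \<notin> cbox 0 1 - box 0 (1 :: real ^ 'n)"
      using negligible_frontier_interval[of 0 "1 :: real ^ 'n"]
      by (intro AE_not_in) (simp add: negligible_iff_null_sets)
    moreover have "AE x in lebesgue. A < f x \<longrightarrow>
        (\<exists>k. A * measure lebesgue (dcell k x) < (LINT y:dcell k x|lebesgue. f y))"
      using par by (intro AE_dyadic_mean_exceeds int f0) auto
    ultimately show "AE x in lebesgue. (\<forall>k. \<not> G k x) \<longrightarrow> ?g x \<le> 0"
    proof (rule AE_mp[OF _ AE_mp], intro AE_I2 impI)
      fix x :: "real ^ 'n"
      assume a: "x \<notin> cbox 0 1 - box 0 1"
        and b: "A < f x \<longrightarrow> (\<exists>k. A * measure lebesgue (dcell k x) < (LINT y:dcell k x|lebesgue. f y))"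
        and c: "\<forall>k. \<not> G k x"
      have "f x \<le> A"
      proof (rule ccontr)
        assume "\<not> f x \<le> A"
        then have fA: "A < f x" by simp
        then have "x \<in> box 0 1" using a supp[of x] par by auto
        then have x: "\<forall>i. 0 \<le> x $ i \<and> x $ i < 1" by (auto simp: mem_box_cart less_imp_le)
        define hi where "hi k \<longleftrightarrow> A * measure lebesgue (dcell k x) < (LINT y:dcell k x|lebesgue. f y)" for k
        have "\<exists>k. hi k" using b fA by (simp add: hi_def)
        \<comment> \<open>A cell of level \<open>0\<close> has measure \<open>1\<close>, so its mean
          is at most the full integral of \<open>f\<close>, hence at most \<open>A\<close>.\<close>
        have hi0: "\<not> hi 0"
        proof -
          have "(LINT y:dcell 0 x|lebesgue. f y) \<le> (LINT y|lebesgue. f y)"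
            unfolding set_lebesgue_integral_def
            using f0 int integrable_indicator_times[OF int(1) sets_dcell, of 0 x]
            by (intro integral_mono) (auto simp: indicator_def)
          then show ?thesis using mean by (simp add: hi_def measure_dcell)
        qed
        \<comment> \<open>Where the cell means around \<open>x\<close> pass \<open>A\<close>, the
          two consecutive cells are the parent and the child that \<open>G\<close> asks for, with
          \<open>z = x\<close>.\<close>
        have "\<exists>k. \<not> hi k \<and> hi (Suc k)"
        proof (rule ccontr)
          assume "\<nexists>k. \<not> hi k \<and> hi (Suc k)"
          then have "\<not> hi k" for k using hi0 by (induction k) auto
          with \<open>\<exists>k. hi k\<close> show False by blast
        qed
        then obtain k where "\<not> hi k" "hi (Suc k)" by blast
        then have "G k x" using x by (auto simp: G_def hi_def intro!: bexI[of _ x])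
        then show False using c by blast
      qed
      then show "?g x \<le> 0"
      proof (cases "\<eta> < f x")
        case True
        then have "chord_gap p \<eta> A (f x) \<le> 0" "0 \<le> ?K * (f x - \<eta>)"
          using \<open>f x \<le> A\<close> par K0 by (auto intro: chord_gap_nonpos simp del: mult_nonneg_nonneg intro!: mult_nonneg_nonneg)
        then have "chord_gap p \<eta> A (f x) - ?K * (f x - \<eta>) \<le> 0" by linarith
        then show ?thesis using True by simp
      qed simp
    qed
  qed
qed

section \<open>The non-increasing rearrangement\<close>

lemma measure_unit_cube: "measure lebesgue (unit_cube :: (real ^ 'n::finite) set) = 1"
proof -
  have "measure lborel (unit_cube :: (real ^ 'n) set) = 1"
    by (subst content_cbox_cart) (auto simp: interval_eq_empty_cart not_less)
  then show ?thesis by simp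
qed

lemma emeasure_unit_cube: "emeasure lebesgue (unit_cube :: (real ^ 'n::finite) set) = 1"
  using measure_unit_cube by (subst emeasure_eq_measure2) auto

text \<open>A hyperplane orthogonal to one axis is moved through \<open>S\<close>. The measure of
  the part behind it is a 1-Lipschitz function of its position, so the intermediate value theorem
  applies.\<close>

lemma exists_subset_of_measure:
  fixes S :: "(real ^ 'n::finite) set"
  assumes S: "S \<in> sets lebesgue" "S \<subseteq> unit_cube" and u: "0 \<le> u" "u \<le> measure lebesgue S"
  obtains E where "E \<subseteq> S" "E \<in> sets lebesgue" "emeasure lebesgue E = ennreal u"
proof -
  define k :: 'n where "k = undefined"
  have cube: "unit_cube \<in> (lmeasurable :: (real ^ 'n) set set)" by simp
  have half[measurable]: "{x :: real ^ 'n. x $ k \<le> r} \<in> sets lebesgue" for r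
  proof -
    have "closed {x :: real ^ 'n. x $ k \<le> r}"
      by (intro closed_Collect_le continuous_intros)
    then show ?thesis by simp
  qed
  have lm: "X \<in> lmeasurable" if "X \<in> sets lebesgue" "X \<subseteq> unit_cube" for X :: "(real ^ 'n) set"
    using fmeasurableI2[OF cube that(2,1)] .
  define F where "F r = measure lebesgue (S \<inter> {x. x $ k \<le> r})" for r
  have step: "F r \<le> F s \<and> F s - F r \<le> s - r" if "r \<le> s" for r s
  proof
    have S1: "S \<inter> {x. x $ k \<le> r} \<in> lmeasurable" "S \<inter> {x. x $ k \<le> s} \<in> lmeasurable" for r s
      using S half by (auto intro!: lm)
    show "F r \<le> F s"
      unfolding F_def using S1 that by (intro measure_mono_fmeasurable fmeasurableD) auto
    \<comment> \<open>What is gained between positions \<open>r\<close> and \<open>s\<close> lies in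
      a slab of thickness \<open>s - r\<close> with unit cross-section.\<close>
    define a b :: "real ^ 'n" where "a = (\<chi> i. if i = k then r else 0)" and "b = (\<chi> i. if i = k then s else 1)"
    have "F s - F r = measure lebesgue ((S \<inter> {x. x $ k \<le> s}) - (S \<inter> {x. x $ k \<le> r}))"
      unfolding F_def using that S1 by (intro measurable_measure_Diff[symmetric] fmeasurableD) auto
    also have "\<dots> \<le> measure lebesgue (cbox a b)"
    proof (rule measure_mono_fmeasurable)
      show "S \<inter> {x. x $ k \<le> s} - S \<inter> {x. x $ k \<le> r} \<subseteq> cbox a b"
      proof
        fix x assume "x \<in> S \<inter> {x. x $ k \<le> s} - S \<inter> {x. x $ k \<le> r}"
        then have "x \<in> unit_cube" "x $ k \<le> s" "r \<le> x $ k" using S by auto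
        then show "x \<in> cbox a b" by (auto simp: mem_box_cart a_def b_def)
      qed
      show "S \<inter> {x. x $ k \<le> s} - S \<inter> {x. x $ k \<le> r} \<in> sets lebesgue"
        using S1 by (intro sets.Diff fmeasurableD)
    qed simp
    also have "\<dots> = (\<Prod>i\<in>UNIV. b $ i - a $ i)"
    proof -
      have "a \<in> cbox a b" using that by (auto simp: mem_box_cart a_def b_def)
      then show ?thesis by (subst measure_completion) (auto intro: content_cbox_cart)
    qed
    also have "\<dots> = (\<Prod>i\<in>UNIV. if i = k then s - r else 1)"
      by (intro prod.cong) (auto simp: a_def b_def)
    also have "\<dots> = s - r" by simp
    finally show "F s - F r \<le> s - r" .
  qed
  have "1-lipschitz_on UNIV F"
  proof (rule lipschitz_onI)
    show "dist (F r) (F s) \<le> 1 * dist r s" for r s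
      using step[of r s] step[of s r] by (cases "r \<le> s") (auto simp: dist_real_def)
  qed auto
  then have "continuous_on UNIV F" by (rule lipschitz_on_continuous_on)
  \<comment> \<open>At \<open>-1\<close> the part behind the hyperplane is literally empty, at
    \<open>1\<close> it is all of \<open>S\<close>.\<close>
  then have c: "continuous_on {-1..1} F" by (rule continuous_on_subset) simp
  have S01: "0 \<le> x $ k" "x $ k \<le> 1" if "x \<in> S" for x
  proof -
    have "x \<in> unit_cube" using that S by blast
    then show "0 \<le> x $ k" "x $ k \<le> 1" by (auto simp: mem_box_cart)
  qed
  have "S \<inter> {x. x $ k \<le> -1} = {}"
  proof (rule equals0I)
    fix x assume "x \<in> S \<inter> {x. x $ k \<le> -1}"
    then show False using S01(1)[of x] by simp
  qed
  then have "F (-1) \<le> u" using u by (simp add: F_def)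
  moreover have "S \<inter> {x. x $ k \<le> 1} = S"
    using S01(2) by blast
  then have "u \<le> F 1" using u by (simp add: F_def)
  ultimately obtain r where r: "F r = u" using IVT'[of F "-1" u 1] c by auto
  show thesis
  proof
    show "S \<inter> {x. x $ k \<le> r} \<subseteq> S" by blast
    show "S \<inter> {x. x $ k \<le> r} \<in> sets lebesgue" using S half by auto
    then have "S \<inter> {x. x $ k \<le> r} \<in> lmeasurable" using S by (intro lm) auto
    then show "emeasure lebesgue (S \<inter> {x. x $ k \<le> r}) = ennreal u"
      using r by (simp add: emeasure_eq_measure2 F_def)
  qed
qed

section \<open>Distribution function and equimeasurability\<close>

locale nonneg_on_unit_cube =
  fixes \<phi> :: "real ^ 'n::finite \<Rightarrow> real"
  assumes meas: "\<phi> \<in> borel_measurable (lebesgue_on unit_cube)"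
    and nonneg: "\<And>x. x \<in> unit_cube \<Longrightarrow> 0 \<le> \<phi> x"
begin

abbreviation "M \<equiv> lebesgue_on (unit_cube :: (real ^ 'n) set)"

definition superlevel :: "real \<Rightarrow> (real ^ 'n) set" where
  "superlevel l = {x \<in> unit_cube. l < \<phi> x}"

text \<open>The distribution function of \<open>\<phi>\<close>.\<close>

definition \<mu> :: "real \<Rightarrow> real" where
  "\<mu> l = measure lebesgue (superlevel l)"

lemma superlevel_sets_M: "superlevel l \<in> sets M"
  using borel_measurable_less[OF borel_measurable_const meas, of l] by (simp add: superlevel_def)

lemma superlevel_lmeasurable: "superlevel l \<in> lmeasurable"
proof (rule fmeasurableI2)
  show "unit_cube \<in> (lmeasurable :: (real ^ 'n) set set)" by simp
  show "superlevel l \<in> sets lebesgue"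
    using superlevel_sets_M[of l] by (simp add: sets_restrict_space_iff)
qed (auto simp: superlevel_def)

lemma emeasure_superlevel: "emeasure lebesgue (superlevel l) = ennreal (\<mu> l)"
  using superlevel_lmeasurable by (simp add: \<mu>_def emeasure_eq_measure2)

lemma mu_bounds: "0 \<le> \<mu> l" "\<mu> l \<le> 1"
proof -
  have "measure lebesgue (superlevel l) \<le> measure lebesgue (unit_cube :: (real ^ 'n) set)"
    using superlevel_lmeasurable by (intro measure_mono_fmeasurable) (auto simp: superlevel_def)
  then show "0 \<le> \<mu> l" "\<mu> l \<le> 1" by (auto simp: \<mu>_def measure_unit_cube)
qed

text \<open>A competitor \<open>E\<close> whose infimum exceeds \<open>l\<close> is contained in
  \<open>superlevel l\<close>. Together with the partial converse below this decides
  \<open>l < rearrangement \<phi> u\<close> except for \<open>u = \<mu> l\<close>.\<close>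

lemma mu_ge_if_rearrangement_greater:
  assumes u: "0 < u" "u \<le> 1" and l: "l < rearrangement \<phi> u"
  shows "u \<le> \<mu> l"
proof -
  note lv = rearrangement_levels[OF meas u]
  obtain E :: "(real ^ 'n) set" where E: "E \<subseteq> unit_cube" "E \<in> sets lebesgue" "emeasure lebesgue E = ennreal u"
      and lE: "l < (INF x \<in> E. \<bar>\<phi> x\<bar>)"
    using l unfolding rearrangement_def less_cSUP_iff[OF lv(1,3)] by auto
  have bb: "bdd_below ((\<lambda>x. \<bar>\<phi> x\<bar>) ` E)" using lv(2)[of E] E by simp
  have "E \<subseteq> superlevel l"
  proof
    fix x assume "x \<in> E"
    then have "(INF x \<in> E. \<bar>\<phi> x\<bar>) \<le> \<bar>\<phi> x\<bar>" using bb by (intro cINF_lower)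
    then show "x \<in> superlevel l" using lE nonneg[of x] E \<open>x \<in> E\<close> by (auto simp: superlevel_def)
  qed
  then have "ennreal u \<le> ennreal (\<mu> l)"
    unfolding E(3)[symmetric] emeasure_superlevel[symmetric]
    using superlevel_lmeasurable by (intro emeasure_mono fmeasurableD)
  then show ?thesis using mu_bounds by simp
qed

text \<open>By continuity of measure from below, some level strictly above \<open>l\<close> still
  has a superlevel set of measure at least \<open>u\<close>, and a subset of measure exactly
  \<open>u\<close> is a competitor. Raising the level makes the final inequality strict.\<close>

lemma rearrangement_greater_if_mu_greater:
  assumes u: "0 < u" "u \<le> 1" and l: "u < \<mu> l"
  shows "l < rearrangement \<phi> u"
proof -
  have "(\<lambda>n. emeasure lebesgue (superlevel (l + 1 / real (Suc n)))) \<longlonglongrightarrow>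
      emeasure lebesgue (\<Union>n. superlevel (l + 1 / real (Suc n)))"
  proof (rule Lim_emeasure_incseq)
    show "range (\<lambda>n. superlevel (l + 1 / real (Suc n))) \<subseteq> sets lebesgue"
      using superlevel_lmeasurable by (auto intro: fmeasurableD)
    have "1 / real (Suc n) \<le> 1 / real (Suc m)" if "m \<le> n" for m n
      using that by (intro divide_left_mono) auto
    then show "incseq (\<lambda>n. superlevel (l + 1 / real (Suc n)))"
      unfolding incseq_def superlevel_def by (fastforce intro: le_less_trans)
  qed
  moreover have "(\<Union>n. superlevel (l + 1 / real (Suc n))) = superlevel l"
  proof (intro equalityI subsetI)
    fix x assume x: "x \<in> superlevel l"
    then have "0 < \<phi> x - l" by (simp add: superlevel_def)
    then obtain n where "inverse (real (Suc n)) < \<phi> x - l" using reals_Archimedean by blast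
    then show "x \<in> (\<Union>n. superlevel (l + 1 / real (Suc n)))"
      using x by (auto simp: superlevel_def inverse_eq_divide intro!: exI[of _ n])
  next
    fix x assume "x \<in> (\<Union>n. superlevel (l + 1 / real (Suc n)))"
    then obtain n where x: "x \<in> unit_cube" "l + 1 / real (Suc n) < \<phi> x" by (auto simp: superlevel_def)
    have "0 < 1 / real (Suc n)" by simp
    then have "l < \<phi> x" using x(2) by linarith
    then show "x \<in> superlevel l" using x(1) by (simp add: superlevel_def)
  qed
  ultimately have lim: "(\<lambda>n. ennreal (\<mu> (l + 1 / real (Suc n)))) \<longlonglongrightarrow> ennreal (\<mu> l)"
    by (simp add: emeasure_superlevel)
  have "ennreal u < ennreal (\<mu> l)" using l u by (simp add: ennreal_less_iff)
  from order_tendstoD(1)[OF lim this] obtain n where "ennreal u < ennreal (\<mu> (l + 1 / real (Suc n)))"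
    by (auto simp: eventually_sequentially)
  then have n: "u \<le> \<mu> (l + 1 / real (Suc n))" using u by (simp add: ennreal_less_iff)
  obtain E where E: "E \<subseteq> superlevel (l + 1 / real (Suc n))" "E \<in> sets lebesgue" "emeasure lebesgue E = ennreal u"
  proof (rule exists_subset_of_measure[of "superlevel (l + 1 / real (Suc n))" u])
    show "superlevel (l + 1 / real (Suc n)) \<subseteq> unit_cube" unfolding superlevel_def by blast
    show "superlevel (l + 1 / real (Suc n)) \<in> sets lebesgue"
      using superlevel_lmeasurable by (rule fmeasurableD)
    show "0 \<le> u" "u \<le> measure lebesgue (superlevel (l + 1 / real (Suc n)))"
      using u n by (auto simp: \<mu>_def)
  qed
  note lv = rearrangement_levels[OF meas u]
  have Ein: "E \<in> {E. E \<subseteq> unit_cube \<and> E \<in> sets lebesgue \<and> emeasure lebesgue E = ennreal u}"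
    using E by (auto simp: superlevel_def)
  have "l + 1 / real (Suc n) \<le> (INF x \<in> E. \<bar>\<phi> x\<bar>)"
    using lv(2)[OF Ein] E(1) by (intro cINF_greatest) (force simp: superlevel_def)+
  also have "\<dots> \<le> rearrangement \<phi> u"
    unfolding rearrangement_def by (rule cSUP_upper[OF Ein lv(3)])
  finally have "l + 1 / real (Suc n) \<le> rearrangement \<phi> u" .
  moreover have "0 < 1 / real (Suc n)" by simp
  ultimately show ?thesis by linarith
qed

lemma rearrangement_antimono:
  assumes "0 < u" "u \<le> t" "t \<le> 1"
  shows "rearrangement \<phi> t \<le> rearrangement \<phi> u"
proof (rule ccontr)
  assume n: "\<not> ?thesis"
  then have "u \<noteq> t" by auto
  with n have "t \<le> \<mu> (rearrangement \<phi> u)" using assms by (intro mu_ge_if_rearrangement_greater) auto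
  then have "rearrangement \<phi> u < rearrangement \<phi> u"
    using assms \<open>u \<noteq> t\<close> by (intro rearrangement_greater_if_mu_greater) auto
  then show False by simp
qed

lemma rearrangement_nonneg:
  assumes t: "0 < t" "t \<le> 1"
  shows "0 \<le> rearrangement \<phi> t"
proof -
  note lv = rearrangement_levels[OF meas t]
  obtain E :: "(real ^ 'n) set" where E: "E \<in> {E. E \<subseteq> unit_cube \<and> E \<in> sets lebesgue \<and> emeasure lebesgue E = ennreal t}"
    using lv(1) by blast
  have "0 \<le> (INF x \<in> E. \<bar>\<phi> x\<bar>)" using lv(2)[OF E] by (intro cINF_greatest) auto
  also have "\<dots> \<le> rearrangement \<phi> t"
    unfolding rearrangement_def by (rule cSUP_upper[OF E lv(3)])
  finally show ?thesis .
qed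

text \<open>The set lies between \<open>{0<..<\<mu> l}\<close> and \<open>{0<..\<mu> l}\<close>,
  hence equals one of them; both have the same measure.\<close>

lemma rearrangement_superlevel:
  "{u \<in> {0<..1}. l < rearrangement \<phi> u} \<in> sets lebesgue"
  "emeasure lebesgue {u \<in> {0<..1}. l < rearrangement \<phi> u} = ennreal (\<mu> l)"
proof -
  let ?X = "{u \<in> {0<..1}. l < rearrangement \<phi> u}"
  have sub1: "?X \<subseteq> {0<..\<mu> l}"
    using mu_ge_if_rearrangement_greater by (intro subsetI) simp
  have sub2: "{0<..<\<mu> l} \<subseteq> ?X"
  proof
    fix u assume u: "u \<in> {0<..<\<mu> l}"
    then have "0 < u" "u \<le> 1" using mu_bounds(2)[of l] by auto
    then show "u \<in> ?X"
      using rearrangement_greater_if_mu_greater u by simp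
  qed
  have "?X = {0<..<\<mu> l} \<or> ?X = {0<..\<mu> l}"
  proof (cases "\<mu> l \<in> ?X")
    case True
    have "{0<..\<mu> l} \<subseteq> ?X"
    proof
      fix u assume u: "u \<in> {0<..\<mu> l}"
      show "u \<in> ?X"
      proof (cases "u = \<mu> l")
        case True
        then show ?thesis using \<open>\<mu> l \<in> ?X\<close> by (rule ssubst)
      next
        case False
        then have "u \<in> {0<..<\<mu> l}" using u by simp
        then show ?thesis using sub2 by (rule rev_subsetD)
      qed
    qed
    then show ?thesis using sub1 by blast
  next
    case False
    have "?X \<subseteq> {0<..<\<mu> l}"
    proof
      fix u assume u: "u \<in> ?X"
      then have "u \<noteq> \<mu> l" using False by blast
      moreover have "0 < u" "u \<le> \<mu> l" using u sub1 by auto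
      ultimately show "u \<in> {0<..<\<mu> l}" by simp
    qed
    then show ?thesis using sub2 by blast
  qed
  then show "?X \<in> sets lebesgue" "emeasure lebesgue ?X = ennreal (\<mu> l)"
    using mu_bounds(1)[of l] by (elim disjE; simp)+
qed

lemma measurable_rearrangement: "rearrangement \<phi> \<in> borel_measurable (lebesgue_on {0<..1})"
  unfolding borel_measurable_iff_greater
proof
  fix l
  show "{w \<in> space (lebesgue_on {0<..1}). l < rearrangement \<phi> w} \<in> sets (lebesgue_on {0<..1})"
    using rearrangement_superlevel(1)[of l] by (auto simp: sets_restrict_space_iff)
qed

text \<open>Equimeasurability: the two distributions are finite and agree on all half lines
  \<open>{l<..}\<close>, which determines them.\<close>

lemma distr_rearrangement:
  "distr (lebesgue_on {0<..1}) borel (rearrangement \<phi>) = distr M borel \<phi>"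
proof (rule measure_eqI_lessThan)
  fix l
  have "rearrangement \<phi> -` {l<..} \<inter> {0<..1} = {u \<in> {0<..1}. l < rearrangement \<phi> u}"
    "\<phi> -` {l<..} \<inter> unit_cube = superlevel l"
    by (auto simp: superlevel_def)
  then have 1: "emeasure (distr (lebesgue_on {0<..1}) borel (rearrangement \<phi>)) {l<..} =
        emeasure (lebesgue_on {0<..1}) {u \<in> {0<..1}. l < rearrangement \<phi> u}"
    and 2: "emeasure (distr M borel \<phi>) {l<..} = emeasure M (superlevel l)"
    by (simp_all add: emeasure_distr measurable_rearrangement meas)
  have 3: "emeasure (lebesgue_on {0<..1}) {u \<in> {0<..1}. l < rearrangement \<phi> u} = ennreal (\<mu> l)"
    by (rule trans[OF emeasure_restrict_space rearrangement_superlevel(2)]) auto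
  have 4: "emeasure M (superlevel l) = ennreal (\<mu> l)"
    by (rule trans[OF emeasure_restrict_space emeasure_superlevel]) (auto simp: superlevel_def)
  show "emeasure (distr (lebesgue_on {0<..1}) borel (rearrangement \<phi>)) {l<..} < \<infinity>"
    "emeasure (distr (lebesgue_on {0<..1}) borel (rearrangement \<phi>)) {l<..} = emeasure (distr M borel \<phi>) {l<..}"
    unfolding 1 2 3 4 by auto
qed auto

text \<open>Where the rearrangement exceeds \<open>\<eta>\<close>, equimeasurability carries the
  integral over to \<open>\<phi>\<close>. On the rest of \<open>{0<..t}\<close>, of length
  \<open>t - \<mu> \<eta>\<close>, monotonicity forces the value \<open>\<eta>\<close>; this rest
  has positive length only if \<open>\<mu> \<eta> < t\<close>.\<close>

lemma nn_integral_rearrangement: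
  assumes [measurable]: "F \<in> borel_measurable borel" and t: "0 < t" "t \<le> 1"
  defines "\<eta> \<equiv> rearrangement \<phi> t"
  shows "(\<integral>\<^sup>+u\<in>{0<..t}. F (rearrangement \<phi> u) \<partial>lebesgue) =
    (\<integral>\<^sup>+x\<in>superlevel \<eta>. F (\<phi> x) \<partial>lebesgue) + F \<eta> * ennreal (t - \<mu> \<eta>)"
    and "\<mu> \<eta> \<le> t"
proof -
  let ?h = "rearrangement \<phi>"
  define X where "X = {u \<in> {0<..1}. \<eta> < ?h u}"
  note [measurable] = measurable_rearrangement meas
  show mt: "\<mu> \<eta> \<le> t"
  proof (rule ccontr)
    assume "\<not> ?thesis"
    then have "\<eta> < rearrangement \<phi> t" using t by (intro rearrangement_greater_if_mu_greater) auto
    then show False by (simp add: \<eta>_def)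
  qed
  have Xsub: "X \<subseteq> {0<..t}"
  proof
    fix u assume "u \<in> X"
    then have uX: "0 < u" "u \<le> 1" "\<eta> < ?h u" by (auto simp: X_def)
    then have "0 < u" "u \<le> \<mu> \<eta>" using mu_ge_if_rearrangement_greater[of u \<eta>] by blast+
    then show "u \<in> {0<..t}" using mt by simp
  qed
  have Xs: "X \<in> sets lebesgue" and Xm: "emeasure lebesgue X = ennreal (\<mu> \<eta>)"
    unfolding X_def by (rule rearrangement_superlevel)+
  \<comment> \<open>Writing the cut by \<open>X\<close> as a function of \<open>?h u\<close> allows
    the change of variables through the distribution.\<close>
  have Xi: "indicator X u = (indicator {\<eta><..} (?h u) * indicator {0<..1} u :: ennreal)" for u
    by (auto simp: X_def indicator_def)
  have hX: "?h u = \<eta>" if "u \<in> {0<..t} - X" for u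
  proof -
    have "0 < u" "u \<le> t" using that by auto
    then have "\<eta> \<le> ?h u" using t unfolding \<eta>_def by (intro rearrangement_antimono)
    moreover have "\<not> \<eta> < ?h u" using that t \<open>0 < u\<close> \<open>u \<le> t\<close> by (auto simp: X_def)
    ultimately show ?thesis by simp
  qed
  have "(\<integral>\<^sup>+u\<in>{0<..t}. F (?h u) \<partial>lebesgue) =
      (\<integral>\<^sup>+u. F (?h u) * indicator X u + F \<eta> * indicator ({0<..t} - X) u \<partial>lebesgue)"
  proof (rule nn_integral_cong)
    fix u
    show "F (?h u) * indicator {0<..t} u = F (?h u) * indicator X u + F \<eta> * indicator ({0<..t} - X) u"
      using Xsub hX[of u] by (cases "u \<in> X"; cases "u \<in> {0<..t}") (auto simp del: greaterThanAtMost_iff)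
  qed
  also have "\<dots> = (\<integral>\<^sup>+u. F (?h u) * indicator X u \<partial>lebesgue) + (\<integral>\<^sup>+u. F \<eta> * indicator ({0<..t} - X) u \<partial>lebesgue)"
  proof (rule nn_integral_add)
    have "(\<lambda>u. F (?h u) * indicator X u) = (\<lambda>u. (F (?h u) * indicator {\<eta><..} (?h u)) * indicator {0<..1} u)"
      by (simp add: Xi mult.assoc)
    moreover have "(\<lambda>u. (F (?h u) * indicator {\<eta><..} (?h u))) \<in> borel_measurable (lebesgue_on {0<..1})"
      by measurable
    ultimately show "(\<lambda>u. F (?h u) * indicator X u) \<in> borel_measurable lebesgue"
      by (simp add: borel_measurable_restrict_space_iff_ennreal)
    show "(\<lambda>u. F \<eta> * indicator ({0<..t} - X) u) \<in> borel_measurable lebesgue"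
      using Xs by (intro borel_measurable_times_ennreal borel_measurable_indicator sets.Diff) auto
  qed
  also have "(\<integral>\<^sup>+u. F \<eta> * indicator ({0<..t} - X) u \<partial>lebesgue) = F \<eta> * ennreal (t - \<mu> \<eta>)"
  proof -
    have "emeasure lebesgue ({0<..t} - X) = emeasure lebesgue {0<..t} - emeasure lebesgue X"
      using Xsub Xs Xm by (intro emeasure_Diff) auto
    also have "\<dots> = ennreal (t - \<mu> \<eta>)"
      using t mu_bounds by (simp add: Xm ennreal_minus)
    finally show ?thesis
      using Xs by (subst nn_integral_cmult_indicator) auto
  qed
  also have "(\<integral>\<^sup>+u. F (?h u) * indicator X u \<partial>lebesgue) =
      (\<integral>\<^sup>+u. F (?h u) * indicator {\<eta><..} (?h u) \<partial>lebesgue_on {0<..1})"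
    by (subst nn_integral_restrict_space) (auto simp: Xi mult.assoc)
  also have "\<dots> = (\<integral>\<^sup>+y. F y * indicator {\<eta><..} y \<partial>distr (lebesgue_on {0<..1}) borel ?h)"
    by (subst nn_integral_distr) auto
  also have "\<dots> = (\<integral>\<^sup>+x. F (\<phi> x) * indicator {\<eta><..} (\<phi> x) \<partial>M)"
    unfolding distr_rearrangement by (subst nn_integral_distr) auto
  also have "\<dots> = (\<integral>\<^sup>+x\<in>superlevel \<eta>. F (\<phi> x) \<partial>lebesgue)"
    by (subst nn_integral_restrict_space) (auto intro!: nn_integral_cong simp: indicator_def superlevel_def)
  finally show "(\<integral>\<^sup>+u\<in>{0<..t}. F (?h u) \<partial>lebesgue) =
    (\<integral>\<^sup>+x\<in>superlevel \<eta>. F (\<phi> x) \<partial>lebesgue) + F \<eta> * ennreal (t - \<mu> \<eta>)" .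
qed

end

section \<open>The reverse Hoelder inequality for the rearrangement\<close>

text \<open>\<open>A\<close> and \<open>B\<close> are meant to be the means over
  \<open>{0<..t}\<close> of the rearrangement and of its \<open>p\<close>-th power, split as in
  \<open>nn_integral_rearrangement\<close>. Inserting both equations turns the integral of
  \<open>dyadic_chord_gap_excess\<close> into \<open>(A - \<eta>) * t\<close> times the difference
  to be estimated.\<close>

lemma dyadic_reverse_holder_truncated:
  fixes f :: "real ^ 'n::finite \<Rightarrow> real"
  assumes int: "integrable lebesgue f" "integrable lebesgue (\<lambda>x. f x powr p)"
    and f0: "\<And>x. 0 \<le> f x" and supp: "\<And>x. x \<notin> unit_cube \<Longrightarrow> f x = 0"
    and rh: "\<And>k x. (\<And>i. 0 \<le> x $ i \<and> x $ i < 1) \<Longrightarrow>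
      (LINT y:dcell k x|lebesgue. f y powr p) \<le> c * measure lebesgue (dcell k x) *
        ((LINT y:dcell k x|lebesgue. f y) / measure lebesgue (dcell k x)) powr p"
    and par: "0 \<le> \<eta>" "1 < p" "1 \<le> c" "0 < t" "t \<le> 1"
  defines "m \<equiv> measure lebesgue {x. \<eta> < f x}"
  assumes tA: "t * A = (LINT x|lebesgue. indicator {x. \<eta> < f x} x * f x) + \<eta> * (t - m)"
    and tB: "t * B = (LINT x|lebesgue. indicator {x. \<eta> < f x} x * f x powr p) + \<eta> powr p * (t - m)"
  shows "0 \<le> A" "0 \<le> B" "B \<le> (2 ^ CARD('n) * c - 2 ^ CARD('n) + 1) * A powr p"
proof -
  let ?i = "indicator {x. \<eta> < f x} :: real ^ 'n \<Rightarrow> real"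
  have cube: "unit_cube \<in> (lmeasurable :: (real ^ 'n) set set)" by simp
  have sub: "{x. \<eta> < f x} \<subseteq> unit_cube"
  proof
    fix x assume "x \<in> {x. \<eta> < f x}"
    then show "x \<in> unit_cube" using supp[of x] par(1) by (cases "x \<in> unit_cube") auto
  qed
  have P: "{x. \<eta> < f x} \<in> sets lebesgue"
    using borel_measurable_less[of "\<lambda>_. \<eta>" lebesgue f] int by simp
  have P': "{x. \<eta> < f x} \<in> lmeasurable" using fmeasurableI2[OF cube sub P] .
  have i1: "integrable lebesgue ?i"
    using P' by (intro integrable_real_indicator) (auto simp: fmeasurable_def)
  have ii: "(LINT x|lebesgue. ?i x) = m" by (simp add: m_def)
  have if1: "integrable lebesgue (\<lambda>x. ?i x * f x)" "integrable lebesgue (\<lambda>x. ?i x * f x powr p)"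
    using int P by (auto intro: integrable_indicator_times)
  have ie: "integrable lebesgue (\<lambda>x. ?i x * f x - \<eta> * ?i x)" using if1 i1 by auto
  have e: "(LINT x|lebesgue. ?i x * f x - \<eta> * ?i x) = t * (A - \<eta>)"
    using if1 i1 tA by (simp add: m_def algebra_simps)
  have en: "0 \<le> ?i x * f x - \<eta> * ?i x" for x by (auto simp: indicator_def)
  have "0 \<le> t * (A - \<eta>)"
    unfolding e[symmetric] by (intro Bochner_Integration.integral_nonneg en)
  then have A\<eta>: "\<eta> \<le> A" using par by (simp add: zero_le_mult_iff)
  then show A0: "0 \<le> A" using par by simp
  have ep: "(LINT x|lebesgue. ?i x * f x powr p - \<eta> powr p * ?i x) = t * (B - \<eta> powr p)"
    using if1 i1 tB by (simp add: m_def algebra_simps)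
  have "0 \<le> t * (B - \<eta> powr p)"
    unfolding ep[symmetric] using par
    by (intro Bochner_Integration.integral_nonneg) (auto simp: indicator_def intro!: powr_mono2)
  then have "\<eta> powr p \<le> B" using par by (simp add: zero_le_mult_iff)
  then show "0 \<le> B" using powr_ge_zero[of \<eta> p] by linarith
  have K: "2 ^ CARD('n) * c - 2 ^ CARD('n) + 1 = 1 + (c - 1) * 2 ^ CARD('n)"
    by (simp add: algebra_simps)
  show "B \<le> (2 ^ CARD('n) * c - 2 ^ CARD('n) + 1) * A powr p"
  \<comment> \<open>For \<open>\<eta> = A\<close> the chord degenerates. Then the excess of
    \<open>f\<close> over \<open>\<eta>\<close> has integral \<open>0\<close>, so \<open>f\<close>
    exceeds \<open>\<eta>\<close> almost nowhere and \<open>B = A powr p\<close>.\<close>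
  proof (cases "\<eta> = A")
    case True
    then have "AE x in lebesgue. ?i x * f x - \<eta> * ?i x = 0"
      using integral_nonneg_eq_0_iff_AE[OF ie] en e by simp
    then have "AE x in lebesgue. ?i x * f x powr p - \<eta> powr p * ?i x = 0"
      by (rule AE_mp) (auto simp: indicator_def)
    then have "t * (B - \<eta> powr p) = 0"
      unfolding ep[symmetric] by (rule integral_eq_zero_AE)
    then have "B = A powr p" using par True by simp
    moreover have "0 \<le> (c - 1) * 2 ^ CARD('n) * A powr p" using par by simp
    ultimately show ?thesis unfolding K by (simp add: algebra_simps)
  next
    case False
    with A\<eta> have A: "\<eta> < A" by simp
    let ?K = "(c - 1) * 2 ^ CARD('n) * A powr p"
    \<comment> \<open>On the cube \<open>f\<close> is at most \<open>\<eta>\<close> plus its excess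
      over \<open>\<eta>\<close>. As \<open>t \<le> 1\<close>, this bounds the mean over the whole
      cube by \<open>A\<close>, where the stopping argument starts.\<close>
    have "(LINT x|lebesgue. f x) \<le> (LINT x|lebesgue. (?i x * f x - \<eta> * ?i x) + \<eta> * indicator unit_cube x)"
    proof (rule integral_mono)
      show "f x \<le> ?i x * f x - \<eta> * ?i x + \<eta> * indicator unit_cube x" for x
        using supp[of x] par by (cases "x \<in> unit_cube") (auto simp: indicator_def)
      have "integrable lebesgue (indicator unit_cube :: real ^ 'n \<Rightarrow> real)"
        using cube by (intro integrable_real_indicator) (auto simp: fmeasurable_def)
      then show "integrable lebesgue (\<lambda>x. ?i x * f x - \<eta> * ?i x + \<eta> * indicat_real unit_cube x)"
        using ie by auto
    qed (rule int)
    also have "\<dots> = t * (A - \<eta>) + \<eta>"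
    proof -
      have "integrable lebesgue (indicator unit_cube :: real ^ 'n \<Rightarrow> real)"
        using cube by (intro integrable_real_indicator) (auto simp: fmeasurable_def)
      then show ?thesis
        using ie e measure_unit_cube[where 'n = 'n] by (subst Bochner_Integration.integral_add) auto
    qed
    also have "\<dots> \<le> A"
    proof -
      have "t * (A - \<eta>) \<le> 1 * (A - \<eta>)" using par A by (intro mult_right_mono) auto
      then show ?thesis by (simp add: algebra_simps)
    qed
    finally have mean: "(LINT x|lebesgue. f x) \<le> A" .
    have "(LINT x|lebesgue. ?i x * (chord_gap p \<eta> A (f x) - ?K * (f x - \<eta>))) \<le> 0"
      using int f0 supp mean rh par A by (intro dyadic_chord_gap_excess) auto
    also have "(LINT x|lebesgue. ?i x * (chord_gap p \<eta> A (f x) - ?K * (f x - \<eta>))) =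
        (LINT x|lebesgue. (A - \<eta>) * (?i x * f x powr p) - (A - \<eta>) * A powr p * ?i x
          - (A powr p - \<eta> powr p) * (?i x * f x) + (A powr p - \<eta> powr p) * A * ?i x
          - ?K * (?i x * f x - \<eta> * ?i x))"
      by (rule Bochner_Integration.integral_cong) (auto simp: chord_gap_def algebra_simps)
    also have "\<dots> = (A - \<eta>) * (LINT x|lebesgue. ?i x * f x powr p) - (A - \<eta>) * A powr p * m
          - (A powr p - \<eta> powr p) * (LINT x|lebesgue. ?i x * f x) + (A powr p - \<eta> powr p) * A * m
          - ?K * (t * (A - \<eta>))"
      unfolding e[symmetric] ii[symmetric] using if1 i1 by simp
    also have "\<dots> = (A - \<eta>) * (t * B - \<eta> powr p * (t - m)) - (A - \<eta>) * A powr p * m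
          - (A powr p - \<eta> powr p) * (t * A - \<eta> * (t - m)) + (A powr p - \<eta> powr p) * A * m
          - ?K * (t * (A - \<eta>))"
      using tA tB by simp
    also have "\<dots> = ((A - \<eta>) * t) * (B - (A powr p + ?K))"
      by (simp add: algebra_simps)
    finally have "B - (A powr p + ?K) \<le> 0"
      using A par by (simp add: mult_le_0_iff)
    then show ?thesis unfolding K by (simp add: algebra_simps)
  qed
qed

lemma ennreal_powr_ennreal: "0 \<le> x \<Longrightarrow> ennreal_powr (ennreal x) p = ennreal (x powr p)"
  by (simp add: ennreal_powr_def)

theorem theorem1:
  fixes \<phi> :: "real ^ 'n::finite \<Rightarrow> real" and p c :: real
  assumes "\<phi> \<in> borel_measurable (lebesgue_on unit_cube)"
    and "\<And>x. x \<in> unit_cube \<Longrightarrow> 0 \<le> \<phi> x"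
    and "p > 1" and "c \<ge> 1"
    and "\<And>Q. dyadic_subcube Q \<Longrightarrow>
      (\<integral>\<^sup>+x\<in>Q. ennreal (\<phi> x powr p) \<partial>lebesgue) / emeasure lebesgue Q
        \<le> ennreal c * ennreal_powr ((\<integral>\<^sup>+x\<in>Q. ennreal (\<phi> x) \<partial>lebesgue) / emeasure lebesgue Q) p"
  shows "\<forall>t\<in>{0<..1}.
    (\<integral>\<^sup>+u\<in>{0<..t}. ennreal (rearrangement \<phi> u powr p) \<partial>lebesgue) / ennreal t
      \<le> ennreal (2 ^ CARD('n) * c - 2 ^ CARD('n) + 1) *
         ennreal_powr ((\<integral>\<^sup>+u\<in>{0<..t}. ennreal (rearrangement \<phi> u) \<partial>lebesgue) / ennreal t) p"
proof
  fix t :: real assume "t \<in> {0<..1}"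
  then have t: "0 < t" "t \<le> 1" by auto
  interpret nonneg_on_unit_cube \<phi> using assms(1,2) by unfold_locales
  define \<eta> where "\<eta> = rearrangement \<phi> t"
  have \<eta>0: "0 \<le> \<eta>" unfolding \<eta>_def using t by (rule rearrangement_nonneg)
  define K :: real where "K = 2 ^ CARD('n) * c - 2 ^ CARD('n) + 1"
  have "K = 1 + (c - 1) * 2 ^ CARD('n)" by (simp add: K_def algebra_simps)
  then have K0: "0 < K" using assms(4) by (simp add: add_pos_nonneg)
  \<comment> \<open>Nothing is known about \<open>\<phi>\<close> off the cube; extended by
    \<open>0\<close> it is measurable and nonnegative on the whole space.\<close>
  define f where "f x = indicator unit_cube x * \<phi> x" for x
  have f0: "0 \<le> f x" for x using nonneg[of x] by (auto simp: f_def indicator_def)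
  have supp: "f x = 0" if "x \<notin> unit_cube" for x using that by (simp add: f_def)
  have f\<phi>: "f x = \<phi> x" if "x \<in> unit_cube" for x using that by (simp add: f_def)
  have fm[measurable]: "f \<in> borel_measurable lebesgue"
    using meas unfolding f_def by (subst (asm) borel_measurable_restrict_space_iff) (auto simp: mult.commute)
  have lev: "superlevel \<eta> = {x. \<eta> < f x}"
    using \<eta>0 by (auto simp: superlevel_def f_def indicator_def split: if_splits)
  have Ps: "{x. \<eta> < f x} \<in> sets lebesgue"
    using fmeasurableD[OF superlevel_lmeasurable[of \<eta>]] by (simp add: lev)
  have h1: "(\<integral>\<^sup>+u\<in>{0<..t}. ennreal (rearrangement \<phi> u) \<partial>lebesgue) =
      (\<integral>\<^sup>+x\<in>{x. \<eta> < f x}. ennreal (f x) \<partial>lebesgue) + ennreal \<eta> * ennreal (t - \<mu> \<eta>)"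
    and hp: "(\<integral>\<^sup>+u\<in>{0<..t}. ennreal (rearrangement \<phi> u powr p) \<partial>lebesgue) =
      (\<integral>\<^sup>+x\<in>{x. \<eta> < f x}. ennreal (f x powr p) \<partial>lebesgue) + ennreal (\<eta> powr p) * ennreal (t - \<mu> \<eta>)"
    and mt: "\<mu> \<eta> \<le> t"
  proof -
    have "(\<integral>\<^sup>+x\<in>superlevel \<eta>. ennreal (\<phi> x) \<partial>lebesgue) = (\<integral>\<^sup>+x\<in>{x. \<eta> < f x}. ennreal (f x) \<partial>lebesgue)"
      "(\<integral>\<^sup>+x\<in>superlevel \<eta>. ennreal (\<phi> x powr p) \<partial>lebesgue) = (\<integral>\<^sup>+x\<in>{x. \<eta> < f x}. ennreal (f x powr p) \<partial>lebesgue)"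
      unfolding lev[symmetric] by (auto intro!: nn_integral_cong simp: indicator_def superlevel_def f\<phi>)
    then show "(\<integral>\<^sup>+u\<in>{0<..t}. ennreal (rearrangement \<phi> u) \<partial>lebesgue) =
      (\<integral>\<^sup>+x\<in>{x. \<eta> < f x}. ennreal (f x) \<partial>lebesgue) + ennreal \<eta> * ennreal (t - \<mu> \<eta>)"
      "(\<integral>\<^sup>+u\<in>{0<..t}. ennreal (rearrangement \<phi> u powr p) \<partial>lebesgue) =
      (\<integral>\<^sup>+x\<in>{x. \<eta> < f x}. ennreal (f x powr p) \<partial>lebesgue) + ennreal (\<eta> powr p) * ennreal (t - \<mu> \<eta>)"
      "\<mu> \<eta> \<le> t"
      using nn_integral_rearrangement[OF _ t, of ennreal]
        nn_integral_rearrangement[OF _ t, of "\<lambda>y. ennreal (y powr p)"] by (simp_all add: \<eta>_def)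
  qed
  have cube_f: "(\<integral>\<^sup>+x\<in>unit_cube. ennreal (\<phi> x) \<partial>lebesgue) = (\<integral>\<^sup>+x. ennreal (f x) \<partial>lebesgue)"
    "(\<integral>\<^sup>+x\<in>unit_cube. ennreal (\<phi> x powr p) \<partial>lebesgue) = (\<integral>\<^sup>+x. ennreal (f x powr p) \<partial>lebesgue)"
    by (auto intro!: nn_integral_cong simp: f_def indicator_def)
  let ?L = "(\<integral>\<^sup>+u\<in>{0<..t}. ennreal (rearrangement \<phi> u powr p) \<partial>lebesgue)"
  let ?R = "(\<integral>\<^sup>+u\<in>{0<..t}. ennreal (rearrangement \<phi> u) \<partial>lebesgue)"
  have "?L / ennreal t \<le> ennreal K * ennreal_powr (?R / ennreal t) p"
  \<comment> \<open>An infinite integral of \<open>f\<close> comes from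
    \<open>{x. \<eta> < f x}\<close>, so the right-hand side is infinite. A finite one makes
    \<open>f x powr p\<close> integrable too, by the hypothesis on the whole cube.\<close>
  proof (cases "(\<integral>\<^sup>+x. ennreal (f x) \<partial>lebesgue) = \<infinity>")
    case True
    have "(\<integral>\<^sup>+x. ennreal (f x) \<partial>lebesgue) \<le>
        (\<integral>\<^sup>+x. ennreal (f x) * indicator {x. \<eta> < f x} x + ennreal \<eta> * indicator unit_cube x \<partial>lebesgue)"
      using \<eta>0 by (intro nn_integral_mono) (auto simp: indicator_def supp not_less intro: ennreal_leI)
    also have "\<dots> = (\<integral>\<^sup>+x\<in>{x. \<eta> < f x}. ennreal (f x) \<partial>lebesgue) + ennreal \<eta>"
    proof (subst nn_integral_add)
      show "(\<lambda>x. ennreal (f x) * indicator {x. \<eta> < f x} x) \<in> borel_measurable lebesgue"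
        using Ps fm by (intro borel_measurable_times_ennreal borel_measurable_indicator) auto
      have cube: "unit_cube \<in> sets (lebesgue :: (real ^ 'n) measure)" by simp
      then show "(\<lambda>x. ennreal \<eta> * indicator unit_cube x) \<in> borel_measurable (lebesgue :: (real ^ 'n) measure)"
        by (intro borel_measurable_times_ennreal borel_measurable_indicator) auto
      show "(\<integral>\<^sup>+x\<in>{x. \<eta> < f x}. ennreal (f x) \<partial>lebesgue) +
          (\<integral>\<^sup>+x. ennreal \<eta> * indicator unit_cube x \<partial>(lebesgue :: (real ^ 'n) measure)) =
          (\<integral>\<^sup>+x\<in>{x. \<eta> < f x}. ennreal (f x) \<partial>lebesgue) + ennreal \<eta>"
        unfolding nn_integral_cmult_indicator[OF cube] emeasure_unit_cube by simp
    qed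
    finally have "(\<integral>\<^sup>+x\<in>{x. \<eta> < f x}. ennreal (f x) \<partial>lebesgue) = \<infinity>"
      using True by (simp add: top_unique ennreal_add_eq_top)
    then have "?R = \<infinity>" unfolding h1 by simp
    then have "ennreal_powr (?R / ennreal t) p = \<infinity>"
      using t by (simp add: ennreal_powr_def ennreal_top_divide)
    then show ?thesis using K0 by (simp add: ennreal_mult_top)
  next
    case False
    have int1: "integrable lebesgue f"
      using False f0 by (intro integrableI_nonneg) (auto simp: less_top)
    define I where "I = (LINT x|lebesgue. f x)"
    have nnI: "(\<integral>\<^sup>+x. ennreal (f x) \<partial>lebesgue) = ennreal I"
      unfolding I_def using int1 f0 by (intro nn_integral_eq_integral) auto
    have I0: "0 \<le> I" unfolding I_def using f0 by (intro Bochner_Integration.integral_nonneg)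
    have one: "x / 1 = x" for x :: ennreal by (simp add: divide_ennreal_def)
    have "(\<integral>\<^sup>+x. ennreal (f x powr p) \<partial>lebesgue) \<le> ennreal c * ennreal (I powr p)"
      using assms(5)[OF dyadic_subcube.whole]
      unfolding cube_f nnI emeasure_unit_cube one ennreal_powr_ennreal[OF I0] .
    also have "\<dots> < \<infinity>" by (simp add: ennreal_mult_less_top)
    finally have intp: "integrable lebesgue (\<lambda>x. f x powr p)"
      by (intro integrableI_nonneg) auto
    \<comment> \<open>Cells and closed dyadic cubes differ by null sets, and all integrals are now
      finite, so the hypothesis becomes an inequality between reals.\<close>
    have rh: "(LINT y:dcell k x|lebesgue. f y powr p) \<le> c * measure lebesgue (dcell k x) *
        ((LINT y:dcell k x|lebesgue. f y) / measure lebesgue (dcell k x)) powr p"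
      if x: "\<And>i. 0 \<le> x $ i \<and> x $ i < 1" for k x
    proof -
      let ?P = "dcell k x"
      let ?m = "measure lebesgue ?P"
      have m0: "0 < ?m" by (simp add: measure_dcell)
      have em: "emeasure lebesgue (dcube k x) = ennreal ?m"
        unfolding emeasure_dcell_dcube[symmetric] by (simp add: emeasure_dcell measure_dcell)
      have Pu: "y \<in> unit_cube" if "y \<in> ?P" for y
        using dcell_subset_unit[OF x that] by (auto simp: mem_box_cart less_imp_le)
      have eq: "(\<integral>\<^sup>+y\<in>dcube k x. ennreal (F (\<phi> y)) \<partial>lebesgue) = ennreal (LINT y:?P|lebesgue. F (f y))"
        if F: "integrable lebesgue (\<lambda>x. F (f x))" "\<And>y. 0 \<le> F y" for F :: "real \<Rightarrow> real"
      proof -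
        have "(\<integral>\<^sup>+y\<in>dcube k x. ennreal (F (\<phi> y)) \<partial>lebesgue) = (\<integral>\<^sup>+y. ennreal (indicator ?P y * F (f y)) \<partial>lebesgue)"
        proof (rule nn_integral_cong_AE)
          show "AE y in lebesgue. ennreal (F (\<phi> y)) * indicator (dcube k x) y = ennreal (indicator ?P y * F (f y))"
            using AE_not_in[OF dcell_null[of k x]]
          proof (rule AE_mp, intro AE_I2 impI)
            fix y assume "y \<notin> dcube k x - ?P"
            then show "ennreal (F (\<phi> y)) * indicator (dcube k x) y = ennreal (indicator ?P y * F (f y))"
              using dcell_subset_dcube[of k x] Pu[of y] by (cases "y \<in> ?P") (auto simp: f\<phi>)
          qed
        qed
        also have "\<dots> = ennreal (LINT y:?P|lebesgue. F (f y))"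
          unfolding set_lebesgue_integral_def real_scaleR_def
          using F by (intro nn_integral_eq_integral integrable_indicator_times) auto
        finally show ?thesis .
      qed
      let ?J = "LINT y:?P|lebesgue. f y"
      \<comment> \<open>\<open>eq\<close> asks for \<open>F\<close> nonnegative on all reals. The
        identity is replaced by \<open>max 0\<close>, which changes nothing under
        \<open>ennreal\<close>, where negative numbers become \<open>0\<close>.\<close>
      have eq1: "(\<integral>\<^sup>+y\<in>dcube k x. ennreal (\<phi> y) \<partial>lebesgue) = ennreal ?J"
      proof -
        have "(\<integral>\<^sup>+y\<in>dcube k x. ennreal (\<phi> y) \<partial>lebesgue) = (\<integral>\<^sup>+y\<in>dcube k x. ennreal (max 0 (\<phi> y)) \<partial>lebesgue)"
          by (intro nn_integral_cong) (simp add: max_def ennreal_neg)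
        also have "\<dots> = ennreal (LINT y:?P|lebesgue. max 0 (f y))"
          using int1 f0 by (intro eq) (auto simp: max_absorb2)
        finally show ?thesis using f0 by (simp add: max_absorb2)
      qed
      have J0: "0 \<le> ?J" unfolding set_lebesgue_integral_def
        using f0 by (intro Bochner_Integration.integral_nonneg) auto
      have Jp0: "0 \<le> (LINT y:?P|lebesgue. f y powr p)" unfolding set_lebesgue_integral_def
        by (intro Bochner_Integration.integral_nonneg) auto
      have "ennreal (LINT y:?P|lebesgue. f y powr p) / ennreal ?m
          \<le> ennreal c * ennreal_powr (ennreal ?J / ennreal ?m) p"
        using assms(5)[OF dyadic_subcube_dcube[OF x, of k]] eq[of "\<lambda>y. y powr p"] intp
        by (simp add: em eq1)
      then have "ennreal ((LINT y:?P|lebesgue. f y powr p) / ?m) \<le> ennreal (c * (?J / ?m) powr p)"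
        using m0 J0 Jp0 assms(4) by (simp add: divide_ennreal ennreal_powr_ennreal ennreal_mult)
      then have "(LINT y:?P|lebesgue. f y powr p) / ?m \<le> c * (?J / ?m) powr p"
        using assms(4) by (subst (asm) ennreal_le_iff) auto
      then show ?thesis using m0 by (simp add: field_simps)
    qed
    let ?i = "indicator {x. \<eta> < f x} :: real ^ 'n \<Rightarrow> real"
    have mm: "\<mu> \<eta> = measure lebesgue {x. \<eta> < f x}" by (simp add: \<mu>_def lev)
    define I1 where "I1 = (LINT x|lebesgue. ?i x * f x)"
    define Ip where "Ip = (LINT x|lebesgue. ?i x * f x powr p)"
    have nn: "0 \<le> I1" "0 \<le> Ip" unfolding I1_def Ip_def
      using f0 by (auto intro!: Bochner_Integration.integral_nonneg)
    have "(\<integral>\<^sup>+x\<in>{x. \<eta> < f x}. ennreal (f x) \<partial>lebesgue) = (\<integral>\<^sup>+x. ennreal (?i x * f x) \<partial>lebesgue)"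
      "(\<integral>\<^sup>+x\<in>{x. \<eta> < f x}. ennreal (f x powr p) \<partial>lebesgue) = (\<integral>\<^sup>+x. ennreal (?i x * f x powr p) \<partial>lebesgue)"
      by (auto intro!: nn_integral_cong simp: indicator_def)
    moreover have "(\<integral>\<^sup>+x. ennreal (?i x * f x) \<partial>lebesgue) = ennreal I1"
      "(\<integral>\<^sup>+x. ennreal (?i x * f x powr p) \<partial>lebesgue) = ennreal Ip"
      unfolding I1_def Ip_def using int1 intp Ps f0
      by (auto intro!: nn_integral_eq_integral integrable_indicator_times)
    ultimately have R: "?R = ennreal (I1 + \<eta> * (t - \<mu> \<eta>))" and L: "?L = ennreal (Ip + \<eta> powr p * (t - \<mu> \<eta>))"
      unfolding h1 hp using nn mt \<eta>0 by (simp_all add: ennreal_mult ennreal_plus)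
    define A where "A = (I1 + \<eta> * (t - \<mu> \<eta>)) / t"
    define B where "B = (Ip + \<eta> powr p * (t - \<mu> \<eta>)) / t"
    have AB: "0 \<le> A" "0 \<le> B" "B \<le> K * A powr p"
    proof -
      have "t * A = (LINT x|lebesgue. ?i x * f x) + \<eta> * (t - measure lebesgue {x. \<eta> < f x})"
        "t * B = (LINT x|lebesgue. ?i x * f x powr p) + \<eta> powr p * (t - measure lebesgue {x. \<eta> < f x})"
        using t by (simp_all add: A_def B_def mm I1_def Ip_def)
      note * = dyadic_reverse_holder_truncated[OF int1 intp f0 supp rh \<eta>0 assms(3,4) t this]
      show "0 \<le> A" "0 \<le> B" "B \<le> K * A powr p" using * by (simp_all add: K_def)
    qed
    have "?R / ennreal t = ennreal A" "?L / ennreal t = ennreal B"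
      unfolding R L A_def B_def using t nn mt \<eta>0
      by (intro divide_ennreal add_nonneg_nonneg mult_nonneg_nonneg; simp)+
    then show ?thesis
      using AB K0 by (simp add: ennreal_powr_ennreal flip: ennreal_mult)
  qed
  then show "?L / ennreal t \<le> ennreal (2 ^ CARD('n) * c - 2 ^ CARD('n) + 1) * ennreal_powr (?R / ennreal t) p"
    by (simp only: K_def)
qed

end
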